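(* Let $d\ge 2$, let $\alpha>0$, and let $Z=(Z_t,t\ge0)$ with probabilities $P_x$, $x\in\mathbb{R}^d$, be a self-similar Markov process on $\mathbb{R}^d$ with index $\alpha$. Let $(\xi,\Theta)$, with probabilities $\mathbf{P}_{x,\theta}$, $x\in\mathbb{R}$, $\theta\in\mathbb{S}_{d-1}$, be the (possibly killed) Markov additive process associated with $Z$ through the generalised Lamperti--Kiu transform. Then $Z$ is isotropic if and only if, for every orthogonal $d\times d$ matrix $U$, every $x\in\mathbb{R}$ and every $\theta\in\mathbb{S}_{d-1}$, the law of $(\xi,U^{-1}\Theta)$ under $\mathbf{P}_{x,\theta}$ equals the law of $(\xi,\Theta)$ under $\mathbf{P}_{x,U^{-1}\theta}$.
   Context: $\mathbb{S}_{d-1}=\{x\in\mathbb{R}^d:|x|=1\}$. A self-similar Markov process on $\mathbb{R}^d$ with index $\alpha>0$ is a Feller process $Z$ on $\mathbb{R}^d$, absorbed at the origin, such that for all $x\in\mathbb{R}^d\setminus\{0\}$ and $c>0$ the law of $(cZ_{c^{-\alpha}t},t\ge0)$ under $P_x$ is $P_{cx}$. A Markov additive process (MAP) on $\mathbb{R}\times\mathbb{S}_{d-1}$ is an $\mathbb{R}\times\mathbb{S}_{d-1}$-valued Feller process $(\xi,\Theta)$ with probabilities $\mathbf{P}_{x,\theta}$ and cemetery state $(-\infty,\dagger)$ such that $\Theta$ is a Feller process on $\mathbb{S}_{d-1}$ with cemetery $\dagger$ and, for all bounded measurable $f$ with $f(-\infty,\dagger)=0$, $s,t\ge0$, on $\{t<\varsigma\}$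 where $\varsigma=\inf\{t>0:\Theta_t=\dagger\}$, $\mathbf{E}_{x,\theta}[f(\xi_{t+s}-\xi_t,\Theta_{t+s})\mid\sigma((\xi_u,\Theta_u),u\le t)]=\mathbf{E}_{0,\Theta_t}[f(\xi_s,\Theta_s)]$. Generalised Lamperti--Kiu transform: every such $Z$ can be written as $Z_t=e^{\xi_{\varphi(t)}}\Theta_{\varphi(t)}$ for $t<I_\varsigma:=\int_0^\varsigma e^{\alpha\xi_s}ds$ (and $Z_t=0$ afterwards), where $\varphi(t)=\inf\{s>0:\int_0^s e^{\alpha\xi_u}du>t\}$, with $(\xi_0,\Theta_0)=(\log|x|,x/|x|)$ when $Z_0=x$; $(\xi,\Theta)$ is the MAP associated with $Z$. $Z$ is isotropic if for every orthogonal matrix $U$ and $x\in\mathbb{R}^d$ the law of $(U^{-1}Z,P_x)$ equals that of $(Z,P_{U^{-1}x})$. *)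

theory Defs
  imports "HOL-Probability.Probability"
begin

definition law :: "'w measure \<Rightarrow> ('w \<Rightarrow> real \<Rightarrow> 's::topological_space) \<Rightarrow> (real \<Rightarrow> 's) measure" where
  "law M X = distr M (PiM {0..} (\<lambda>_. borel)) (\<lambda>\<omega>. restrict (X \<omega>) {0..})"

definition cadlag :: "(real \<Rightarrow> 's::topological_space) \<Rightarrow> bool" where
  "cadlag f \<longleftrightarrow> (\<forall>t\<ge>0. continuous (at_right t) f \<and> (t > 0 \<longrightarrow> (\<exists>l. (f \<longlongrightarrow> l) (at_left t))))"

definition nat_filt :: "'w measure \<Rightarrow> ('w \<Rightarrow> real \<Rightarrow> 's::topological_space) \<Rightarrow> real \<Rightarrow> 'w measure" where
  "nat_filt M X t = sigma (space M)
     {(\<lambda>\<omega>. X \<omega> u) -` A \<inter> space M | u A. 0 \<le> u \<and> u \<le> t \<and> A \<in> sets borel}"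

definition C0_on :: "'s::topological_space set \<Rightarrow> ('s \<Rightarrow> real) \<Rightarrow> bool" where
  "C0_on E f \<longleftrightarrow> continuous_on E f \<and>
     (\<forall>e>0. \<exists>K. compact K \<and> K \<subseteq> E \<and> (\<forall>y\<in>E - K. \<bar>f y\<bar> < e))"

text \<open>Transition semigroup, with the convention that functions vanish at the cemetery set K.\<close>
definition semigrp :: "('s \<Rightarrow> 'w measure) \<Rightarrow> ('w \<Rightarrow> real \<Rightarrow> 's) \<Rightarrow> 's set \<Rightarrow> real \<Rightarrow> ('s \<Rightarrow> real) \<Rightarrow> 's \<Rightarrow> real" where
  "semigrp P X K s f y = (if y \<in> K then 0 else (\<integral>\<omega>. f (X \<omega> s) \<partial>P y))"

text \<open>Feller process with state space E and (possibly empty) set K of cemetery states,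
  given in canonical form: a family of probability measures P x (x \<in> E) on a common
  sample space and a process X with cadlag paths.  K is absorbing, test functions vanish on K.\<close>
definition feller_process :: "'s::topological_space set \<Rightarrow> 's set \<Rightarrow> ('s \<Rightarrow> 'w measure) \<Rightarrow> ('w \<Rightarrow> real \<Rightarrow> 's) \<Rightarrow> bool" where
  "feller_process E K P X \<longleftrightarrow>
     E \<inter> K = {} \<and>
     (\<forall>x\<in>E. prob_space (P x)) \<and>
     (\<forall>x\<in>E. \<forall>t\<ge>0. (\<lambda>\<omega>. X \<omega> t) \<in> measurable (P x) borel) \<and>
     (\<forall>x\<in>E. AE \<omega> in P x. X \<omega> 0 = x) \<and>
     (\<forall>x\<in>E. \<forall>\<omega>\<in>space (P x). \<forall>t\<ge>0. X \<omega> t \<in> E \<union> K) \<and>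
     (\<forall>x\<in>E. \<forall>\<omega>\<in>space (P x). \<forall>t\<ge>0. \<forall>s\<ge>0. X \<omega> t \<in> K \<longrightarrow> X \<omega> (t + s) = X \<omega> t) \<and>
     (\<forall>x\<in>E. \<forall>\<omega>\<in>space (P x). cadlag (X \<omega>)) \<and>
     (\<forall>f. C0_on E f \<and> (\<forall>k\<in>K. f k = 0) \<longrightarrow>
          (\<forall>t\<ge>0. C0_on E (semigrp P X K t f)) \<and>
          (\<forall>y\<in>E. ((\<lambda>t. semigrp P X K t f y) \<longlongrightarrow> f y) (at_right 0))) \<and>
     (\<forall>x\<in>E. \<forall>s\<ge>0. \<forall>t\<ge>0. \<forall>(f :: 's \<Rightarrow> real) (g :: 'w \<Rightarrow> real).
          f \<in> borel_measurable borel \<and> bounded (range f) \<and> (\<forall>k\<in>K. f k = 0) \<and>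
          g \<in> borel_measurable (nat_filt (P x) X t) \<and> bounded (range g) \<longrightarrow>
          (\<integral>\<omega>. g \<omega> * f (X \<omega> (t + s)) \<partial>P x) = (\<integral>\<omega>. g \<omega> * semigrp P X K s f (X \<omega> t) \<partial>P x))"

definition ssMp :: "real \<Rightarrow> (real^'n \<Rightarrow> 'w measure) \<Rightarrow> ('w \<Rightarrow> real \<Rightarrow> real^'n) \<Rightarrow> bool" where
  "ssMp \<alpha> P Z \<longleftrightarrow> \<alpha> > 0 \<and>
     feller_process UNIV {} P Z \<and>
     (\<forall>x. \<forall>\<omega>\<in>space (P x). \<forall>t\<ge>0. \<forall>s\<ge>0. Z \<omega> t = 0 \<longrightarrow> Z \<omega> (t + s) = 0) \<and>
     (\<forall>x. x \<noteq> 0 \<longrightarrow> (\<forall>c>0.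
        law (P x) (\<lambda>\<omega> t. c *\<^sub>R Z \<omega> (c powr (- \<alpha>) * t)) = law (P (c *\<^sub>R x)) Z))"

definition isotropic :: "(real^'n \<Rightarrow> 'w measure) \<Rightarrow> ('w \<Rightarrow> real \<Rightarrow> real^'n) \<Rightarrow> bool" where
  "isotropic P Z \<longleftrightarrow> (\<forall>U :: real^'n^'n. orthogonal_matrix U \<longrightarrow>
     (\<forall>x. law (P x) (\<lambda>\<omega> t. matrix_inv U *v Z \<omega> t) = law (P (matrix_inv U *v x)) Z))"

text \<open>States are pairs (ereal, vector); the cemetery (-\<infinity>, \<dagger>) is encoded as (-\<infinity>, 0),
  and the cemetery \<dagger> of \<Theta> as the zero vector (which is not on the sphere).\<close>

definition lifetime :: "(real \<Rightarrow> real^'n) \<Rightarrow> ereal" where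
  "lifetime \<Theta> = Inf (ereal ` {u. 0 < u \<and> \<Theta> u = 0})"

definition MAP_states :: "(ereal \<times> (real^'n)) set" where
  "MAP_states = {(ereal x, \<theta>) | x \<theta>. \<theta> \<in> sphere 0 1}"

definition is_MAP :: "('v \<Rightarrow> real \<Rightarrow> ereal) \<Rightarrow> ('v \<Rightarrow> real \<Rightarrow> real^'n) \<Rightarrow> (ereal \<times> (real^'n) \<Rightarrow> 'v measure) \<Rightarrow> bool" where
  "is_MAP \<xi> \<Theta> Pb \<longleftrightarrow>
     feller_process MAP_states {(-\<infinity>, 0)} Pb (\<lambda>\<omega> t. (\<xi> \<omega> t, \<Theta> \<omega> t)) \<and>
     feller_process (sphere 0 1) {0} (\<lambda>\<theta>. Pb (0, \<theta>)) \<Theta> \<and>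
     (\<forall>z\<in>MAP_states. \<forall>s\<ge>0. \<forall>t\<ge>0. \<forall>(f :: ereal \<times> (real^'n) \<Rightarrow> real) (g :: 'v \<Rightarrow> real).
        f \<in> borel_measurable borel \<and> bounded (range f) \<and> f (-\<infinity>, 0) = 0 \<and>
        g \<in> borel_measurable (nat_filt (Pb z) (\<lambda>\<omega> t. (\<xi> \<omega> t, \<Theta> \<omega> t)) t) \<and> bounded (range g) \<longrightarrow>
        (\<integral>\<omega>. g \<omega> * indicator {\<omega>. ereal t < lifetime (\<Theta> \<omega>)} \<omega> *
              f (\<xi> \<omega> (t + s) - \<xi> \<omega> t, \<Theta> \<omega> (t + s)) \<partial>Pb z)
        = (\<integral>\<omega>. g \<omega> * indicator {\<omega>. ereal t < lifetime (\<Theta> \<omega>)} \<omega> *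
              (\<integral>\<omega>'. f (\<xi> \<omega>' s, \<Theta> \<omega>' s) \<partial>Pb (0, \<Theta> \<omega> t)) \<partial>Pb z))"

definition eexp :: "ereal \<Rightarrow> real" where
  "eexp y = (case y of ereal r \<Rightarrow> exp r | _ \<Rightarrow> 0)"

definition lk_clock :: "real \<Rightarrow> (real \<Rightarrow> ereal) \<Rightarrow> real \<Rightarrow> ennreal" where
  "lk_clock \<alpha> \<xi> s = (\<integral>\<^sup>+ u \<in> {0..s}. ennreal (eexp (ereal \<alpha> * \<xi> u)) \<partial>lborel)"

definition lk_time :: "real \<Rightarrow> (real \<Rightarrow> ereal) \<Rightarrow> real \<Rightarrow> real" where
  "lk_time \<alpha> \<xi> t = Inf {s. 0 < s \<and> lk_clock \<alpha> \<xi> s > ennreal t}"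

definition lk_total :: "real \<Rightarrow> (real \<Rightarrow> ereal) \<Rightarrow> (real \<Rightarrow> real^'n) \<Rightarrow> ennreal" where
  "lk_total \<alpha> \<xi> \<Theta> = (\<integral>\<^sup>+ u \<in> {u. 0 \<le> u \<and> ereal u < lifetime \<Theta>}. ennreal (eexp (ereal \<alpha> * \<xi> u)) \<partial>lborel)"

definition lk_path :: "real \<Rightarrow> (real \<Rightarrow> ereal) \<Rightarrow> (real \<Rightarrow> real^'n) \<Rightarrow> real \<Rightarrow> real^'n" where
  "lk_path \<alpha> \<xi> \<Theta> t =
     (if ennreal t < lk_total \<alpha> \<xi> \<Theta>
      then eexp (\<xi> (lk_time \<alpha> \<xi> t)) *\<^sub>R \<Theta> (lk_time \<alpha> \<xi> t) else 0)"

definition LK_associated :: "real \<Rightarrow> (real^'n \<Rightarrow> 'w measure) \<Rightarrow> ('w \<Rightarrow> real \<Rightarrow> real^'n) \<Rightarrow>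
     (ereal \<times> (real^'n) \<Rightarrow> 'v measure) \<Rightarrow> ('v \<Rightarrow> real \<Rightarrow> ereal) \<Rightarrow> ('v \<Rightarrow> real \<Rightarrow> real^'n) \<Rightarrow> bool" where
  "LK_associated \<alpha> P Z Pb \<xi> \<Theta> \<longleftrightarrow>
     (\<forall>x. x \<noteq> 0 \<longrightarrow>
        law (Pb (ereal (ln (norm x)), sgn x)) (\<lambda>\<omega>. lk_path \<alpha> (\<xi> \<omega>) (\<Theta> \<omega>)) = law (P x) Z)"

end

theory Submission
  imports Defs
begin

text \<open>Encode the pair \<open>(\<xi>, \<Theta>)\<close> as the single path \<open>y = e\<^sup>\<xi> \<Theta>\<close>, absorbed at \<open>0\<close>, from which
  \<open>(ln |y|, y / |y|)\<close> recovers the pair. The Lamperti--Kiu transform is then the time change of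
  \<open>y\<close> with clock \<open>\<integral> |y|\<^sup>\<alpha>\<close>. It commutes with linear isometries, and its inverse is the time change
  with clock \<open>\<integral> |y|\<close> to the power \<open>-\<alpha>\<close>, provided that the first clock stays finite until
  absorption. Both time changes are determined by the law of the path, so equality of laws
  passes in both directions.

  Finiteness of the clock has to be derived from the Feller property: paths are cadlag only in the
  extended reals, so a priori \<open>\<xi>\<close> may have the left limit \<open>+\<infinity>\<close> at a time at which the process is
  still alive. Since the semigroup maps functions vanishing at infinity to such functions, the
  expected time that the process spends near a compact set after \<open>\<xi>\<close> has reached the level \<open>L\<close>
  tends to \<open>0\<close> as \<open>L\<close> grows, which rules this out almost surely.\<close>

text \<open>The equivalence is proved separately for each orthogonal matrix and each nonzero
  starting point; the origin is treated by hand. The only path regularity used for \<open>y\<close>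
  is right-continuity: if \<xi> climbs to \<open>\<infinity>\<close> at some time before absorption,
  then \<open>y\<close> has no left limit in the vector space there. Zero serves at once as the code
  of the cemetery, as the absorbing origin of \<open>Z\<close> and as the default value once the
  clock is exhausted, so the three conventions agree. The two directions are not symmetric. The
  forward time change makes sense for every absorbed path, but it discards whatever follows an
  explosion of the clock; only the recovery of \<open>y\<close> from its time change needs the
  almost sure finiteness. For this a single test function, strictly positive on all living states,
  is enough: it decays at high levels under the semigroup, and yet its integral over a time window
  after a living time cannot vanish.\<close>

definition right_cont :: "(real \<Rightarrow> 'a::topological_space) \<Rightarrow> bool" where
  "right_cont w \<longleftrightarrow> (\<forall>t\<ge>0. (w \<longlongrightarrow> w t) (at_right t))"

text \<open>As a measure, the clock inherits additivity and continuity from below. The argument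
  \<open>max 0 u\<close> hides the values at negative times, which laws do not see. Since
  \<open>0 powr \<beta> = 0\<close> even for negative exponents, the inverse clock also stops at
  absorption.\<close>

definition clock_measure :: "real \<Rightarrow> (real \<Rightarrow> 'a::real_normed_vector) \<Rightarrow> real measure" where
  "clock_measure \<beta> w = density lborel (\<lambda>u. ennreal (norm (w (max 0 u)) powr \<beta>) * indicator {0..} u)"

definition clock :: "real \<Rightarrow> (real \<Rightarrow> 'a::real_normed_vector) \<Rightarrow> real \<Rightarrow> ennreal" where
  "clock \<beta> w s = emeasure (clock_measure \<beta> w) {0..s}"

definition clock_total :: "real \<Rightarrow> (real \<Rightarrow> 'a::real_normed_vector) \<Rightarrow> ennreal" where
  "clock_total \<beta> w = emeasure (clock_measure \<beta> w) {0..}"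

text \<open>The right-continuous inverse of the clock, written in the form of \<open>lk_time\<close>
  so that the two coincide once the clocks do.\<close>

definition clock_inv :: "real \<Rightarrow> (real \<Rightarrow> 'a::real_normed_vector) \<Rightarrow> real \<Rightarrow> real" where
  "clock_inv \<beta> w t = Inf {s. 0 < s \<and> clock \<beta> w s > ennreal t}"

definition time_change :: "real \<Rightarrow> (real \<Rightarrow> 'a::real_normed_vector) \<Rightarrow> real \<Rightarrow> 'a" where
  "time_change \<beta> w t = (if ennreal t < clock_total \<beta> w then w (clock_inv \<beta> w t) else 0)"

text \<open>The times before both absorption and explosion of the clock; the time change retains exactly
  this part of the path.\<close>

definition live :: "real \<Rightarrow> (real \<Rightarrow> 'a::real_normed_vector) \<Rightarrow> real set" where
  "live \<beta> w = {s. 0 \<le> s \<and> w s \<noteq> 0 \<and> clock \<beta> w s < \<top>}"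

definition absorbed_path :: "(real \<Rightarrow> 'a::real_normed_vector) \<Rightarrow> bool" where
  "absorbed_path w \<longleftrightarrow> right_cont w \<and> (\<forall>t\<ge>0. \<forall>s\<ge>t. w t = 0 \<longrightarrow> w s = 0)"

section \<open>Joint measurability of right-continuous processes\<close>

lemma grid_approx:
  fixes u :: real
  assumes "0 \<le> u"
  shows "(\<lambda>n. (real (nat \<lfloor>2 ^ n * u\<rfloor>) + 1) / 2 ^ n) \<longlonglongrightarrow> u"
    and "u < (real (nat \<lfloor>2 ^ n * u\<rfloor>) + 1) / 2 ^ n"
proof -
  \<comment> \<open>The \<open>+ 1\<close> puts the dyadic point strictly to the right of
    \<open>u\<close>; rounding down would approach \<open>u\<close> from the left, where nothing is
    known about the path.\<close>
  have b: "u < (real (nat \<lfloor>2 ^ n * u\<rfloor>) + 1) / 2 ^ n \<and> (real (nat \<lfloor>2 ^ n * u\<rfloor>) + 1) / 2 ^ n \<le> u + (1 / 2) ^ n" for n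
  proof -
    have "0 \<le> 2 ^ n * u" using assms by simp
    then have e: "real (nat \<lfloor>2 ^ n * u\<rfloor>) = of_int \<lfloor>2 ^ n * u\<rfloor>"
      by (simp add: of_nat_nat)
    have "2 ^ n * u < of_int \<lfloor>2 ^ n * u\<rfloor> + 1" "of_int \<lfloor>2 ^ n * u\<rfloor> \<le> 2 ^ n * u"
      by linarith+
    then show ?thesis unfolding e by (simp add: field_simps)
  qed
  show "u < (real (nat \<lfloor>2 ^ n * u\<rfloor>) + 1) / 2 ^ n" using b by blast
  have l: "(\<lambda>n. u + (1/2::real) ^ n) \<longlonglongrightarrow> u + 0"
    by (intro tendsto_intros LIMSEQ_power_zero) simp
  show "(\<lambda>n. (real (nat \<lfloor>2 ^ n * u\<rfloor>) + 1) / 2 ^ n) \<longlonglongrightarrow> u"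
    by (rule tendsto_sandwich[OF _ _ tendsto_const, where h="\<lambda>n. u + (1/2::real) ^ n"])
      (use b l in \<open>auto intro!: eventuallyI less_imp_le\<close>)
qed

text \<open>The dyadic approximations take countably many time values, so each is jointly
  measurable, and right-continuity makes them converge pointwise.\<close>

lemma right_cont_process_measurable:
  fixes X :: "'w \<Rightarrow> real \<Rightarrow> 'b::metric_space"
  assumes X: "\<And>u. u \<ge> 0 \<Longrightarrow> (\<lambda>\<omega>. X \<omega> u) \<in> borel_measurable M"
    and rc: "\<And>\<omega>. \<omega> \<in> space M \<Longrightarrow> right_cont (X \<omega>)"
  shows "(\<lambda>(\<omega>, u). X \<omega> (max 0 u)) \<in> borel_measurable (M \<Otimes>\<^sub>M borel)"
proof (rule borel_measurable_LIMSEQ_metric)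
  let ?k = "\<lambda>n u. nat \<lfloor>2 ^ n * max 0 (u::real)\<rfloor>"
  let ?f = "\<lambda>n (\<omega>, u). X \<omega> ((real (?k n u) + 1) / 2 ^ n)"
  show "?f n \<in> borel_measurable (M \<Otimes>\<^sub>M borel)" for n
  proof -
    have "(\<lambda>p. (\<lambda>k p. X (fst p) ((real k + 1) / 2 ^ n)) ((\<lambda>p. ?k n (snd p)) p) p)
        \<in> borel_measurable (M \<Otimes>\<^sub>M (borel :: real measure))"
      by (rule measurable_compose_countable)
        (auto intro!: measurable_compose[OF measurable_fst X])
    then show ?thesis by (simp add: case_prod_beta)
  qed
  fix p assume "p \<in> space (M \<Otimes>\<^sub>M (borel :: real measure))"
  then obtain \<omega> u where p: "p = (\<omega>, u)" "\<omega> \<in> space M" by (auto simp: space_pair_measure)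
  let ?u = "max 0 u"
  have "filterlim (\<lambda>n. (real (?k n u) + 1) / 2 ^ n) (at_right ?u) sequentially"
    unfolding filterlim_at
  proof (intro conjI always_eventually allI)
    fix n
    have g: "?u < (real (?k n u) + 1) / 2 ^ n" by (rule grid_approx(2)) simp
    show "(real (?k n u) + 1) / 2 ^ n \<in> {?u<..}" using g by (simp only: greaterThan_iff)
    show "(real (?k n u) + 1) / 2 ^ n \<noteq> ?u" using g by (rule less_imp_neq[THEN not_sym])
  qed (rule grid_approx(1), simp)
  moreover have "(X \<omega> \<longlongrightarrow> X \<omega> ?u) (at_right ?u)"
    using rc[OF p(2)] by (simp add: right_cont_def)
  ultimately show "(\<lambda>n. ?f n p) \<longlonglongrightarrow> (case p of (\<omega>, u) \<Rightarrow> X \<omega> (max 0 u))"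
    by (auto simp: p intro: filterlim_compose)
qed

lemma right_cont_measurable:
  fixes w :: "real \<Rightarrow> 'b::metric_space"
  assumes "right_cont w"
  shows "(\<lambda>u. w (max 0 u)) \<in> borel_measurable borel"
proof -
  have "(\<lambda>(\<omega>, u). w (max 0 u)) \<in> borel_measurable (count_space {()} \<Otimes>\<^sub>M (borel :: real measure))"
    by (rule right_cont_process_measurable) (use assms in auto)
  from measurable_compose[OF measurable_Pair1' this, of "()"] show ?thesis by simp
qed

section \<open>The clock of a path\<close>

lemma sets_clock_measure [simp, measurable_cong]: "sets (clock_measure \<beta> w) = sets borel"
  by (simp add: clock_measure_def)

lemma clock_measurable:
  fixes w :: "real \<Rightarrow> 'a::euclidean_space"
  assumes "right_cont w"
  shows "(\<lambda>u. ennreal (norm (w (max 0 u)) powr \<beta>)) \<in> borel_measurable borel"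
  using right_cont_measurable[OF assms] by measurable

lemma emeasure_clock_measure:
  fixes w :: "real \<Rightarrow> 'a::euclidean_space"
  assumes "right_cont w" "A \<in> sets borel" "A \<subseteq> {0..}"
  shows "emeasure (clock_measure \<beta> w) A = (\<integral>\<^sup>+u\<in>A. ennreal (norm (w u) powr \<beta>) \<partial>lborel)"
proof -
  note [measurable] = clock_measurable[OF assms(1), of \<beta>] assms(2)
  have m: "(\<lambda>u. ennreal (norm (w (max 0 u)) powr \<beta>) * indicator {0..} u) \<in> borel_measurable lborel"
    by measurable
  show ?thesis unfolding clock_measure_def
    by (subst emeasure_density[OF m]) (use assms in \<open>auto intro!: nn_integral_cong simp: indicator_def max_def\<close>)
qed

lemma clock_mono: "s \<le> t \<Longrightarrow> clock \<beta> w s \<le> clock \<beta> w t"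
  unfolding clock_def by (rule emeasure_mono) auto

lemma clock_le_total: "clock \<beta> w s \<le> clock_total \<beta> w"
  unfolding clock_def clock_total_def by (rule emeasure_mono) auto

lemma clock_total_SUP: "clock_total \<beta> w = (SUP n. clock \<beta> w (real n))"
proof -
  have "(SUP n. clock \<beta> w (real n)) = emeasure (clock_measure \<beta> w) (\<Union>n. {0..real n})"
    unfolding clock_def by (rule SUP_emeasure_incseq) (auto simp: incseq_def)
  also have "(\<Union>n. {0..real n}) = {0..}" by (auto intro: real_arch_simple)
  finally show ?thesis by (simp add: clock_total_def)
qed

lemma clock_add:
  assumes "0 \<le> s" "s \<le> t"
  shows "clock \<beta> w t = clock \<beta> w s + emeasure (clock_measure \<beta> w) {s<..t}"
  unfolding clock_def by (subst plus_emeasure) (use assms in \<open>auto intro!: arg_cong2[where f=emeasure]\<close>)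

lemma clock_0:
  fixes w :: "real \<Rightarrow> 'a::euclidean_space"
  assumes "right_cont w" shows "clock \<beta> w 0 = 0"
proof -
  have "AE u in lborel. u \<noteq> (0::real)" by (rule AE_lborel_singleton)
  then have "(\<integral>\<^sup>+u\<in>{0}. ennreal (norm (w u) powr \<beta>) \<partial>lborel) = (\<integral>\<^sup>+u. 0 \<partial>(lborel :: real measure))"
    by (intro nn_integral_cong_AE) (auto simp: indicator_def)
  then show ?thesis using assms by (simp add: clock_def emeasure_clock_measure)
qed

section \<open>The time change of a fixed absorbed path\<close>

context
  fixes w :: "real \<Rightarrow> 'a::euclidean_space" and \<beta> :: real
  assumes w: "absorbed_path w"
begin

lemma right_cont_path: "right_cont w"
  using w by (simp add: absorbed_path_def)

lemma absorbed: "0 \<le> t \<Longrightarrow> t \<le> s \<Longrightarrow> w t = 0 \<Longrightarrow> w s = 0"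
  using w by (auto simp: absorbed_path_def)

text \<open>Shortly after a nonzero value the norm stays away from zero, so the density is bounded
  for negative exponents too.\<close>

lemma eventually_right_pos:
  assumes "0 \<le> s" "w s \<noteq> 0"
  obtains d where "0 < d"
    "\<And>u. s < u \<Longrightarrow> u < s + d \<Longrightarrow> w u \<noteq> 0 \<and> norm (w u) powr \<beta> \<le> norm (w s) powr \<beta> + 1"
proof -
  have l: "(w \<longlongrightarrow> w s) (at_right s)" using right_cont_path assms by (simp add: right_cont_def)
  have "((\<lambda>u. norm (w u) powr \<beta>) \<longlongrightarrow> norm (w s) powr \<beta>) (at_right s)"
    by (intro tendsto_intros l) (use assms in auto)
  then have "eventually (\<lambda>u. norm (w u) powr \<beta> < norm (w s) powr \<beta> + 1) (at_right s)"
    by (rule order_tendstoD) simp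
  moreover have "eventually (\<lambda>u. w u \<noteq> 0) (at_right s)"
    using l assms(2) by (rule tendsto_imp_eventually_ne)
  ultimately have "eventually (\<lambda>u. w u \<noteq> 0 \<and> norm (w u) powr \<beta> \<le> norm (w s) powr \<beta> + 1) (at_right s)"
    by eventually_elim auto
  then obtain b where "b > s" "\<forall>y>s. y < b \<longrightarrow> w y \<noteq> 0 \<and> norm (w y) powr \<beta> \<le> norm (w s) powr \<beta> + 1"
    unfolding eventually_at_right_field by blast
  then show ?thesis by (intro that[of "b - s"]) auto
qed

lemma live_down: "s \<in> live \<beta> w \<Longrightarrow> 0 \<le> t \<Longrightarrow> t \<le> s \<Longrightarrow> t \<in> live \<beta> w"
  using absorbed clock_mono[of t s \<beta> w] by (auto simp: live_def)

text \<open>The live set has no greatest element: the density is bounded just after a live time, so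
  the clock stays finite a little longer.\<close>

lemma live_up:
  assumes "s \<in> live \<beta> w" "s < t0"
  shows "\<exists>t\<in>live \<beta> w. s < t \<and> t < t0"
proof -
  from assms obtain d where d: "0 < d"
    "\<And>u. s < u \<Longrightarrow> u < s + d \<Longrightarrow> w u \<noteq> 0 \<and> norm (w u) powr \<beta> \<le> norm (w s) powr \<beta> + 1"
    by (auto simp: live_def intro: eventually_right_pos)
  define C where "C = norm (w s) powr \<beta> + 1"
  define t where "t = min (s + d / 2) ((s + t0) / 2)"
  have t: "s < t" "t < s + d" "t < t0" "0 \<le> s" using d assms by (auto simp: t_def live_def min_def field_simps)
  have "emeasure (clock_measure \<beta> w) {s<..t} = (\<integral>\<^sup>+u\<in>{s<..t}. ennreal (norm (w u) powr \<beta>) \<partial>lborel)"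
    using t by (intro emeasure_clock_measure right_cont_path) auto
  also have "\<dots> \<le> (\<integral>\<^sup>+u\<in>{s<..t}. ennreal C \<partial>lborel)"
    by (intro nn_integral_mono) (use d t in \<open>auto simp: indicator_def C_def[symmetric] intro!: ennreal_leI\<close>)
  also have "\<dots> = ennreal C * ennreal (t - s)" using t by (simp add: nn_integral_cmult_indicator)
  also have "\<dots> < \<top>" by (simp add: ennreal_mult_less_top)
  finally have "clock \<beta> w t < \<top>"
    using clock_add[of s t \<beta> w] t assms by (auto simp: live_def)
  then have "t \<in> live \<beta> w" using t d by (auto simp: live_def)
  then show ?thesis using t by blast
qed

text \<open>The density is positive just after \<open>s\<close>, so a zero increment would make a
  nondegenerate open interval null. The clock at \<open>t\<close> may be infinite.\<close>

lemma clock_strict: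
  assumes "s \<in> live \<beta> w" "s < t"
  shows "clock \<beta> w s < clock \<beta> w t"
proof -
  from assms obtain d where d: "0 < d" "\<And>u. s < u \<Longrightarrow> u < s + d \<Longrightarrow> w u \<noteq> 0"
    by (auto simp: live_def intro: eventually_right_pos)
  let ?t = "min t (s + d)"
  have s: "0 \<le> s" using assms by (simp add: live_def)
  have "emeasure (clock_measure \<beta> w) {s<..t} \<noteq> 0"
  proof
    assume "emeasure (clock_measure \<beta> w) {s<..t} = 0"
    then have "(\<integral>\<^sup>+u. ennreal (norm (w (max 0 u)) powr \<beta>) * indicator {s<..t} u \<partial>lborel) = 0"
      using s by (subst (asm) emeasure_clock_measure[OF right_cont_path])
        (auto simp: indicator_def max_def intro!: nn_integral_cong elim!: trans[rotated])
    then have "AE u in lborel. ennreal (norm (w (max 0 u)) powr \<beta>) * indicator {s<..t} u = 0"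
      using clock_measurable[OF right_cont_path, of \<beta>] by (subst (asm) nn_integral_0_iff_AE) auto
    then have "AE u in lborel. u \<notin> {s<..<?t}"
    proof eventually_elim
      case (elim u)
      show ?case
      proof
        assume u: "u \<in> {s<..<?t}"
        then have "w u \<noteq> 0" using d by auto
        then show False using elim u s by (auto simp: indicator_def max_def split: if_splits)
      qed
    qed
    then have "emeasure lborel {s<..<?t} = 0"
      by (subst (asm) AE_iff_measurable[of "{s<..<?t}"]) auto
    then show False using d assms by (simp add: ennreal_eq_0_iff split: if_splits)
  qed
  then show ?thesis
    using clock_add[of s t \<beta> w] s assms by (auto simp: live_def less_top zero_less_iff_neq_zero intro!: le_neq_trans)
qed

text \<open>As long as it is finite, the clock is the indefinite integral of an integrable function,
  hence continuous.\<close>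

lemma clock_ivt:
  assumes "clock \<beta> w s < \<top>" "0 \<le> s" "0 \<le> t" "ennreal t \<le> clock \<beta> w s"
  shows "\<exists>v\<in>{0..s}. clock \<beta> w v = ennreal t"
proof -
  let ?h = "\<lambda>u. norm (w (max 0 u)) powr \<beta>"
  have hm [measurable]: "?h \<in> borel_measurable borel"
    using right_cont_measurable[OF right_cont_path] by measurable
  have eq: "clock \<beta> w v = (\<integral>\<^sup>+u. ennreal (?h u * indicator {0..v} u) \<partial>lborel)" for v
    unfolding clock_def by (subst emeasure_clock_measure[OF right_cont_path])
      (auto intro!: nn_integral_cong simp: indicator_def max_def)
  have int: "(?h has_integral enn2real (clock \<beta> w v)) {0..v}" if "v \<le> s" for v
  proof -
    have fin: "clock \<beta> w v < \<top>" using clock_mono[OF that] assms(1) by (rule le_less_trans)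
    have "((\<lambda>u. ?h u * indicator {0..v} u) has_integral enn2real (clock \<beta> w v)) UNIV"
      by (rule nn_integral_has_integral) (use fin in \<open>auto simp: eq[symmetric]\<close>)
    moreover have "(\<lambda>u. ?h u * indicator {0..v} u) = (\<lambda>u. if u \<in> {0..v} then ?h u else 0)"
      by (auto simp: indicator_def)
    ultimately show ?thesis by (simp only: has_integral_restrict_UNIV)
  qed
  have cont: "continuous_on {0..s} (\<lambda>v. integral {0..v} ?h)"
    by (rule indefinite_integral_continuous_1) (use int[of s] in auto)
  have I: "integral {0..v} ?h = enn2real (clock \<beta> w v)" if "v \<le> s" for v
    using int[OF that] by (rule integral_unique)
  have "enn2real (ennreal t) \<le> enn2real (clock \<beta> w s)" using assms by (intro enn2real_mono) auto
  then have "\<exists>v. 0 \<le> v \<and> v \<le> s \<and> integral {0..v} ?h = t"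
    using assms cont by (intro IVT') (auto simp: I)
  then obtain v where v: "0 \<le> v" "v \<le> s" "enn2real (clock \<beta> w v) = t" by (auto simp: I)
  have "clock \<beta> w v < \<top>" using clock_mono[OF v(2)] assms(1) by (rule le_less_trans)
  then show ?thesis using v by (intro bexI[of _ v]) (auto simp: ennreal_enn2real)
qed

lemma clock_inv_clock:
  assumes "s \<in> live \<beta> w" "clock \<beta> w s = ennreal t"
  shows "clock_inv \<beta> w t = s"
proof -
  have "{u. 0 < u \<and> clock \<beta> w u > ennreal t} = {s<..}"
    using assms clock_strict[of s] clock_mono[of _ s \<beta> w]
    by (force simp: live_def not_less[symmetric])
  then show ?thesis by (simp add: clock_inv_def)
qed

lemma clock_less_total: "s \<in> live \<beta> w \<Longrightarrow> clock \<beta> w s < clock_total \<beta> w"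
  using clock_strict[of s "s + 1"] clock_le_total[of \<beta> w "s + 1"] by auto

text \<open>If all live clock values stayed below \<open>t\<close>, the live times would be bounded,
  with a supremum \<tau> that is not live by \<open>live_up\<close>. Continuity from below bounds
  the clock at \<tau> by \<open>t\<close>, so it has not exploded there; hence the path is zero at
  \<tau>, the clock stops, and its total is at most \<open>t\<close>.\<close>

lemma less_clock_total_live:
  assumes "0 \<le> t" "ennreal t < clock_total \<beta> w"
  shows "\<exists>v\<in>live \<beta> w. clock \<beta> w v = ennreal t"
proof -
  have "\<exists>s\<in>live \<beta> w. ennreal t \<le> clock \<beta> w s"
  proof (rule ccontr)
    assume "\<not> ?thesis"
    then have small: "clock \<beta> w s < ennreal t" if "s \<in> live \<beta> w" for s using that by force
    have dead: "clock_total \<beta> w \<le> clock \<beta> w \<tau>" if "0 \<le> \<tau>" "w \<tau> = 0" for \<tau>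
      using that absorbed[of \<tau>] unfolding clock_total_def clock_def
      by (subst (1 2) emeasure_clock_measure[OF right_cont_path])
        (auto intro!: nn_integral_mono simp: indicator_def)
    have c0: "clock \<beta> w 0 = 0" by (rule clock_0[OF right_cont_path])
    have w0: "w 0 \<noteq> 0" using dead[of 0] c0 assms by auto
    then have live0: "0 \<in> live \<beta> w" by (simp add: live_def c0)
    from assms obtain n where n: "ennreal t < clock \<beta> w (real n)" by (auto simp: clock_total_SUP less_SUP_iff)
    have bnd: "s \<le> real n" if "s \<in> live \<beta> w" for s
      using small[OF that] n clock_mono[of "real n" s \<beta> w] by (force simp: not_le[symmetric])
    define \<tau> where "\<tau> = Sup (live \<beta> w)"
    have bdd: "bdd_above (live \<beta> w)" using bnd by (rule bdd_aboveI)
    have up: "s \<le> \<tau>" if "s \<in> live \<beta> w" for s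
      unfolding \<tau>_def using that bdd by (rule cSup_upper)
    have nl: "\<tau> \<notin> live \<beta> w" using live_up[of \<tau> "\<tau> + 1"] up by force
    have \<tau>0: "0 < \<tau>" using up[OF live0] nl live0 by (cases "\<tau> = 0") auto
    have below: "s \<in> live \<beta> w" if s: "0 \<le> s" "s < \<tau>" for s
     
    proof -
      obtain x where "x \<in> live \<beta> w" "s < x"
        using s less_cSup_iff[OF _ bdd, of s] live0 by (auto simp: \<tau>_def)
      then show ?thesis using live_down s by auto
    qed
    \<comment> \<open>These times increase to \<tau> but remain strictly below it, hence live; the
      endpoint \<tau> itself is a null set for the clock.\<close>
    let ?s = "\<lambda>k. \<tau> * (1 - 1 / real (Suc k))"
    have "clock \<beta> w \<tau> = emeasure (clock_measure \<beta> w) {0..<\<tau>}"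
      unfolding clock_def
      by (subst (1 2) emeasure_clock_measure[OF right_cont_path])
        (use AE_lborel_singleton[of \<tau>] in \<open>auto intro!: nn_integral_cong_AE simp: indicator_def elim!: eventually_mono\<close>)
    also have "{0..<\<tau>} = (\<Union>k. {0..?s k})"
    proof (intro equalityI subsetI)
      fix x assume x: "x \<in> {0..<\<tau>}"
      then have "0 < 1 - x / \<tau>" using \<tau>0 by simp
      then obtain k where "inverse (real (Suc k)) < 1 - x / \<tau>" using reals_Archimedean by blast
      then have "x / \<tau> \<le> 1 - 1 / real (Suc k)" by (simp add: inverse_eq_divide)
      then have "x \<le> ?s k" using \<tau>0 by (simp only: pos_divide_le_eq mult.commute)
      then show "x \<in> (\<Union>k. {0..?s k})" using x by auto
    next
      fix x assume "x \<in> (\<Union>k. {0..?s k})"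
      then obtain k where "0 \<le> x" "x \<le> ?s k" by auto
      moreover have "?s k < \<tau>" using \<tau>0 by simp
      ultimately show "x \<in> {0..<\<tau>}" by auto
    qed
    also have "emeasure (clock_measure \<beta> w) \<dots> = (SUP k. clock \<beta> w (?s k))"
      unfolding clock_def
    proof (rule SUP_emeasure_incseq[symmetric])
      have "?s m \<le> ?s n" if "m \<le> n" for m n
        using \<tau>0 that by (intro mult_left_mono diff_left_mono) (auto intro!: divide_left_mono)
      then show "incseq (\<lambda>k. {0..?s k})"
        by (fastforce simp: incseq_def)
    qed auto
    also have "\<dots> \<le> ennreal t"
    proof (rule SUP_least)
      fix k
      show "clock \<beta> w (?s k) \<le> ennreal t"
        by (rule less_imp_le, rule small, rule below) (use \<tau>0 in auto)
    qed
    finally have le: "clock \<beta> w \<tau> \<le> ennreal t" .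
    then have "w \<tau> = 0" using nl \<tau>0 by (auto simp: live_def intro: le_less_trans)
    then show False using dead[of \<tau>] \<tau>0 le assms by auto
  qed
  then obtain s where s: "s \<in> live \<beta> w" "ennreal t \<le> clock \<beta> w s" by blast
  then obtain v where "v \<in> {0..s}" "clock \<beta> w v = ennreal t"
    using clock_ivt[of s t] assms by (auto simp: live_def)
  then show ?thesis using live_down[OF s(1), of v] by auto
qed

lemma time_change_clock:
  assumes "s \<in> live \<beta> w" "clock \<beta> w s = ennreal t"
  shows "time_change \<beta> w t = w s"
  using clock_less_total[OF assms(1)] clock_inv_clock[OF assms] assms(2) by (simp add: time_change_def)

text \<open>Every clock value below the total belongs to a live time, where the path is nonzero.
  Thus the lifetime of the new path is exactly the total clock.\<close>

lemma time_change_nonzero_iff: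
  assumes "0 \<le> t"
  shows "time_change \<beta> w t \<noteq> 0 \<longleftrightarrow> ennreal t < clock_total \<beta> w"
proof
  assume "ennreal t < clock_total \<beta> w"
  then obtain v where "v \<in> live \<beta> w" "clock \<beta> w v = ennreal t" using less_clock_total_live[OF assms] by blast
  then show "time_change \<beta> w t \<noteq> 0" using time_change_clock[of v t] by (auto simp: live_def)
qed (auto simp: time_change_def split: if_splits)

lemma absorbed_path_time_change: "absorbed_path (time_change \<beta> w)"
  unfolding absorbed_path_def
proof (intro conjI allI impI)
  fix t s assume "0 \<le> t" "t \<le> s" "time_change \<beta> w t = 0"
  moreover from this have "ennreal t \<le> ennreal s" by (simp add: ennreal_leI)
  ultimately show "time_change \<beta> w s = 0"
    using time_change_nonzero_iff[of t] time_change_nonzero_iff[of s]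
    by (meson le_less_trans order_trans)
next
  show "right_cont (time_change \<beta> w)"
    unfolding right_cont_def
  proof (intro allI impI)
    fix t :: real assume t: "0 \<le> t"
    let ?z = "time_change \<beta> w"
    show "(?z \<longlongrightarrow> ?z t) (at_right t)"
    proof (cases "ennreal t < clock_total \<beta> w")
      case False
      have "?z u = 0" if "t < u" for u
        using False time_change_nonzero_iff[of u] that t ennreal_leI[of t u]
        by (meson less_imp_le le_less_trans order_trans)
      moreover have "?z t = 0" using False time_change_nonzero_iff[OF t] by auto
      ultimately show ?thesis
        by (intro tendsto_eventually) (auto simp: eventually_at_right_field intro: exI[of _ "t + 1"])
    next
      case True
      then obtain s where s: "s \<in> live \<beta> w" "clock \<beta> w s = ennreal t" using less_clock_total_live t by blast
      have s0: "0 \<le> s" using s by (simp add: live_def)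
      show ?thesis
      proof (rule topological_tendstoI)
        fix S assume S: "open S" "?z t \<in> S"
        then have "w s \<in> S" using time_change_clock[OF s] by simp
        moreover have "(w \<longlongrightarrow> w s) (at_right s)" using right_cont_path s0 by (simp add: right_cont_def)
        ultimately have "eventually (\<lambda>u. w u \<in> S) (at_right s)" using S by (auto dest: topological_tendstoD)
        then obtain b where b: "b > s" "\<And>u. s < u \<Longrightarrow> u < b \<Longrightarrow> w u \<in> S"
          unfolding eventually_at_right_field by blast
        \<comment> \<open>The clock value of a live time \<open>v\<close> in \<open>(s, b)\<close>
          gives the right neighbourhood of \<open>t\<close>: all clock values strictly between
          belong to live times between \<open>s\<close> and \<open>v\<close>.\<close>
        obtain v where v: "v \<in> live \<beta> w" "s < v" "v < b" using live_up[OF s(1) b(1)] by blast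
        have cv: "clock \<beta> w v < \<top>" "0 \<le> v" using v by (auto simp: live_def)
        define t' where "t' = enn2real (clock \<beta> w v)"
        have t': "clock \<beta> w v = ennreal t'" "0 \<le> t'" using cv by (auto simp: t'_def ennreal_enn2real)
        have tt': "t < t'" using clock_strict[OF s(1) v(2)] t t' s by (simp add: ennreal_less_iff)
        have "?z u \<in> S" if u: "t < u" "u < t'" for u
        proof -
          obtain x where x: "x \<in> {0..v}" "clock \<beta> w x = ennreal u"
            using clock_ivt[OF cv, of u] t' u t by (auto simp: ennreal_leI)
          have xl: "x \<in> live \<beta> w" using live_down[OF v(1)] x by auto
          have "s < x" using clock_mono[of x s \<beta> w] x s u t by (force simp: not_less ennreal_less_iff)
          then have "w x \<in> S" using b v x by auto
          then show ?thesis using time_change_clock[OF xl x(2)] by simp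
        qed
        then show "eventually (\<lambda>u. ?z u \<in> S) (at_right t)"
          unfolding eventually_at_right_field using tt' by blast
      qed
    qed
  qed
qed

text \<open>The clock pushes the measure with density \<open>|w|\<^sup>\<beta>\<close> on \<open>[0,s]\<close> forward to Lebesgue
  measure; along it the integrand of the inverse clock is the reciprocal of that density.\<close>

lemma clock_time_change:
  assumes s: "s \<in> live \<beta> w" and a: "clock \<beta> w s = ennreal a" and a0: "0 \<le> a"
  shows "clock (- \<beta>) (time_change \<beta> w) a = ennreal s"
proof -
  let ?z = "time_change \<beta> w"
  let ?h = "\<lambda>u. ennreal (norm (w (max 0 u)) powr \<beta>) * indicator {0..s} u"
  \<comment> \<open>Capping at \<open>s\<close> makes the clock a finite monotone function on the
    whole line; it is zero at negative arguments.\<close>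
  define \<phi> where "\<phi> v = enn2real (clock \<beta> w (min v s))" for v
  have s0: "0 \<le> s" using s by (simp add: live_def)
  have fin: "clock \<beta> w (min v s) < \<top>" for v
    using clock_mono[of "min v s" s \<beta> w] a by (auto intro: le_less_trans)
  have \<phi>: "clock \<beta> w (min v s) = ennreal (\<phi> v)" "0 \<le> \<phi> v" for v
    using fin[of v] by (auto simp: \<phi>_def ennreal_enn2real)
  have mono\<phi>: "mono \<phi>"
    unfolding \<phi>_def using fin by (intro monoI enn2real_mono clock_mono) auto
  then have \<phi>m [measurable]: "\<phi> \<in> borel_measurable borel" by (rule borel_measurable_mono)
  note hm [measurable] = clock_measurable[OF right_cont_path, of \<beta>]
  have rcz: "right_cont ?z" using absorbed_path_time_change by (simp only: absorbed_path_def)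
  note zm [measurable] = clock_measurable[OF rcz, of "- \<beta>"]
  let ?N = "density lborel ?h"
  have h [measurable]: "?h \<in> borel_measurable lborel" by measurable
  have dens: "emeasure ?N A = (\<integral>\<^sup>+u. ?h u * indicator A u \<partial>lborel)" if "A \<in> sets borel" for A
    by (rule emeasure_density[OF h]) (use that in simp)
  have sets_UNIV_borel: "UNIV \<in> sets (borel :: real measure)" by simp
  have N: "emeasure ?N {x<..} = emeasure (clock_measure \<beta> w) {x<..s}" if "0 \<le> x" for x
    using that by (simp only: dens greaterThan_borel sets_UNIV_borel, subst emeasure_clock_measure[OF right_cont_path])
      (auto simp: indicator_def max_def intro!: nn_integral_cong)
  \<comment> \<open>Both measures have total mass \<open>a\<close>, so it suffices to compare them
    on the half-lines \<open>{x<..}\<close>.\<close>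
  have "distr ?N borel \<phi> = density lborel (indicator {0..a})"
  proof (rule measure_eqI_lessThan)
    fix x :: real
    have L: "emeasure (distr ?N borel \<phi>) {x<..} = emeasure ?N {v. x < \<phi> v}"
      by (subst emeasure_distr) (auto simp: vimage_def)
    have R: "emeasure (density lborel (indicator {0..a})) {x<..} = emeasure lborel ({0..a} \<inter> {x<..})"
      by (subst emeasure_density) (auto simp: indicator_inter_arith[symmetric])
    have top: "emeasure ?N UNIV = ennreal a"
      unfolding a[symmetric] clock_def using s0
      by (simp only: dens greaterThan_borel sets_UNIV_borel, subst emeasure_clock_measure[OF right_cont_path])
      (auto simp: indicator_def max_def intro!: nn_integral_cong)
    show "emeasure (distr ?N borel \<phi>) {x<..} < \<infinity>"
      unfolding L using emeasure_mono[of "{v. x < \<phi> v}" UNIV ?N] top by (auto intro: le_less_trans)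
    consider "x < 0" | "a \<le> x" | "0 \<le> x" "x < a" by linarith
    then show "emeasure (distr ?N borel \<phi>) {x<..} = emeasure (density lborel (indicator {0..a})) {x<..}"
    proof cases
      case 1
      then have "{v. x < \<phi> v} = UNIV" "{0..a} \<inter> {x<..} = {0..a}" using \<phi>(2) by (auto intro: less_le_trans)
      then show ?thesis unfolding L R using top a0 by simp
    next
      case 2
      have "\<phi> v \<le> a" for v
        using clock_mono[of "min v s" s \<beta> w] \<phi>[of v] a a0 by (auto simp: ennreal_le_iff)
      then have "{v. x < \<phi> v} = {}" "{0..a} \<inter> {x<..} = {}" using 2 by (auto simp: not_less intro: order_trans)
      then show ?thesis unfolding L R by simp
    next
      case 3
      \<comment> \<open>Strict growth after the live time \<open>v\<close> with clock value
        \<open>x\<close> turns the superlevel set into \<open>{v<..}\<close>, whose mass is the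
        clock increment \<open>a - x\<close>.\<close>
      then obtain v where v: "v \<in> {0..s}" "clock \<beta> w v = ennreal x"
        using clock_ivt[of s x] a s0 by (auto simp: ennreal_leI)
      have vl: "v \<in> live \<beta> w" using live_down[OF s] v by auto
      have vs: "v < s" using v a 3 a0 by (cases "v = s") auto
      have "{u. x < \<phi> u} = {v<..}"
      proof (intro equalityI subsetI)
        fix u assume "u \<in> {u. x < \<phi> u}"
        then have "clock \<beta> w v < clock \<beta> w (min u s)"
          using \<phi>[of u] v 3 by (simp add: ennreal_less_iff)
        then have "\<not> min u s \<le> v" using clock_mono[of "min u s" v \<beta> w] by auto
        then show "u \<in> {v<..}" using v by auto
      next
        fix u assume "u \<in> {v<..}"
        then have "clock \<beta> w v < clock \<beta> w (min u s)" using vs by (intro clock_strict[OF vl]) auto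
        then show "u \<in> {u. x < \<phi> u}" using \<phi>[of u] v 3 by (simp add: ennreal_less_iff)
      qed
      then have "emeasure (distr ?N borel \<phi>) {x<..} = emeasure (clock_measure \<beta> w) {v<..s}"
        unfolding L using N v by auto
      moreover have "ennreal a = ennreal x + emeasure (clock_measure \<beta> w) {v<..s}"
        using clock_add[of v s \<beta> w] v a by auto
      then have "emeasure (clock_measure \<beta> w) {v<..s} = ennreal (a - x)"
        using 3 by (metis ennreal_add_diff_cancel_left ennreal_minus ennreal_neq_top)
      moreover have "{0..a} \<inter> {x<..} = {x<..a}" using 3 by auto
      ultimately show ?thesis unfolding R using 3 by simp
    qed
  qed auto
  note push = this
  have "clock (- \<beta>) ?z a = (\<integral>\<^sup>+u. indicator {0..a} u * ennreal (norm (?z (max 0 u)) powr - \<beta>) \<partial>lborel)"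
    unfolding clock_def using a0
    by (subst emeasure_clock_measure[OF rcz]) (auto simp: indicator_def max_def intro!: nn_integral_cong)
  also have "\<dots> = (\<integral>\<^sup>+u. ennreal (norm (?z (max 0 u)) powr - \<beta>) \<partial>distr ?N borel \<phi>)"
    unfolding push by (rule nn_integral_density[symmetric]) measurable
  also have "\<dots> = (\<integral>\<^sup>+v. ?h v * ennreal (norm (?z (max 0 (\<phi> v))) powr - \<beta>) \<partial>lborel)"
    by (subst nn_integral_distr) (measurable, rule nn_integral_density, measurable)
  also have "\<dots> = (\<integral>\<^sup>+v. indicator {0..s} v \<partial>lborel)"
  proof (rule nn_integral_cong)
    fix v :: real
    show "?h v * ennreal (norm (?z (max 0 (\<phi> v))) powr - \<beta>) = indicator {0..s} v"
    proof (cases "v \<in> {0..s}")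
      case True
      then have vl: "v \<in> live \<beta> w" using live_down[OF s] by auto
      have "?z (\<phi> v) = w v" using True \<phi>[of v] by (intro time_change_clock[OF vl]) (auto simp: min_def)
      moreover have "norm (w v) powr \<beta> * norm (w v) powr - \<beta> = 1"
        using vl by (auto simp: live_def powr_minus)
      ultimately show ?thesis using True \<phi>(2)[of v] by (simp add: max_def ennreal_mult[symmetric])
    qed simp
  qed
  also have "\<dots> = ennreal s" using s0 by simp
  finally show ?thesis .
qed

end

text \<open>A live \<open>s\<close> with clock value \<open>a\<close> is the value at
  \<open>a\<close> of the inverse clock, so the second time change evaluates the first at
  \<open>a\<close> and returns \<open>w s\<close>. Conversely, each value of the inverse clock at a
  live time of the new path comes from a live time of \<open>w\<close>. What follows an explosion is
  therefore replaced by zero.\<close>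

theorem time_change_inverse:
  fixes w :: "real \<Rightarrow> 'a::euclidean_space"
  assumes w: "absorbed_path w" and s: "0 \<le> s"
  shows "time_change (- \<beta>) (time_change \<beta> w) s = (if s \<in> live \<beta> w then w s else 0)"
proof -
  let ?z = "time_change \<beta> w"
  note z = absorbed_path_time_change[OF w, of \<beta>]
  show ?thesis
  proof (cases "s \<in> live \<beta> w")
    case True
    define a where "a = enn2real (clock \<beta> w s)"
    have a: "clock \<beta> w s = ennreal a" "0 \<le> a" using True by (auto simp: a_def live_def ennreal_enn2real)
    note c = clock_time_change[OF w True a]
    have za: "?z a = w s" by (rule time_change_clock[OF w True a(1)])
    have "a \<in> live (- \<beta>) ?z" using a c za True by (auto simp: live_def)
    then show ?thesis using time_change_clock[OF z _ c] za True by simp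
  next
    case False
    have "\<not> ennreal s < clock_total (- \<beta>) ?z"
    proof
      assume "ennreal s < clock_total (- \<beta>) ?z"
      then obtain t where t: "t \<in> live (- \<beta>) ?z" "clock (- \<beta>) ?z t = ennreal s"
        using less_clock_total_live[OF z s] by blast
      then have "0 \<le> t" "ennreal t < clock_total \<beta> w"
        using time_change_nonzero_iff[OF w] by (auto simp: live_def)
      then obtain v where v: "v \<in> live \<beta> w" "clock \<beta> w v = ennreal t" using less_clock_total_live[OF w] by blast
      then have "ennreal v = ennreal s" using clock_time_change[OF w v] t \<open>0 \<le> t\<close> by simp
      then show False using v False s by (auto simp: live_def)
    qed
    then show ?thesis using False by (simp add: time_change_def)
  qed
qed

section \<open>Measurability of the time change and passage to laws\<close>

lemma right_cont_restrict [simp]: "right_cont (restrict w {0..}) \<longleftrightarrow> right_cont w"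
proof -
  have "(restrict w {0..} \<longlongrightarrow> w t) (at_right t) \<longleftrightarrow> (w \<longlongrightarrow> w t) (at_right t)" if "0 \<le> t" for t
    by (rule tendsto_cong) (use that in \<open>auto simp: eventually_at_right_field intro: exI[of _ "t + 1"]\<close>)
  then show ?thesis by (auto simp: right_cont_def)
qed

lemma clock_cong:
  assumes "\<And>u. 0 \<le> u \<Longrightarrow> v u = w u"
  shows "clock \<beta> v = clock \<beta> w" "clock_total \<beta> v = clock_total \<beta> w"
proof -
  have "(\<lambda>u. v (max 0 u)) = (\<lambda>u. w (max 0 u))" using assms by auto
  then have "clock_measure \<beta> v = clock_measure \<beta> w"
    unfolding clock_measure_def by (metis (no_types))
  then show "clock \<beta> v = clock \<beta> w" "clock_total \<beta> v = clock_total \<beta> w"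
    by (simp_all add: fun_eq_iff clock_def clock_total_def)
qed

lemma clock_inv_set:
  assumes "0 \<le> t" "ennreal t < clock_total \<beta> w"
  shows "{s. 0 < s \<and> clock \<beta> w s > ennreal t} \<noteq> {}"
proof -
  from assms obtain n where "ennreal t < clock \<beta> w (real n)" by (auto simp: clock_total_SUP less_SUP_iff)
  \<comment> \<open>Adding one ensures a strictly positive time, since \<open>n\<close> may be
    zero.\<close>
  then have "ennreal t < clock \<beta> w (real n + 1)"
    using clock_mono[of "real n" "real n + 1" \<beta> w] by auto
  then show ?thesis by (auto intro!: exI[of _ "real n + 1"])
qed

lemma clock_inv_nonneg:
  assumes "0 \<le> t" "ennreal t < clock_total \<beta> w"
  shows "0 \<le> clock_inv \<beta> w t"
  unfolding clock_inv_def using clock_inv_set[OF assms] by (intro cInf_greatest) auto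

text \<open>Laws retain only the restriction of a path to nonnegative times; the inverse clock never
  leaves that range.\<close>

lemma time_change_cong:
  assumes "\<And>u. 0 \<le> u \<Longrightarrow> v u = w u" "0 \<le> t"
  shows "time_change \<beta> v t = time_change \<beta> w t"
  using clock_cong[of v w \<beta>] clock_inv_nonneg[of t \<beta> w] assms
  by (auto simp: time_change_def clock_inv_def)

text \<open>The clock depends on the norm alone, and a linear map fixes the default value
  zero.\<close>

lemma time_change_map:
  assumes V: "linear V" "\<And>x. norm (V x) = norm x"
  shows "time_change \<beta> (\<lambda>t. V (w t)) t = V (time_change \<beta> w t)"
proof -
  have "clock_measure \<beta> (\<lambda>t. V (w t)) = clock_measure \<beta> w"
    by (simp add: clock_measure_def V)
  then show ?thesis
    by (simp add: time_change_def clock_inv_def clock_def clock_total_def linear_0[OF V(1)])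
qed

lemma clock_process_measurable:
  fixes X :: "'w \<Rightarrow> real \<Rightarrow> 'a::euclidean_space"
  assumes X: "\<And>u. u \<ge> 0 \<Longrightarrow> (\<lambda>\<omega>. X \<omega> u) \<in> borel_measurable M"
    and rc: "\<And>\<omega>. \<omega> \<in> space M \<Longrightarrow> right_cont (X \<omega>)"
  shows "(\<lambda>\<omega>. clock \<beta> (X \<omega>) s) \<in> borel_measurable M"
proof -
  note [measurable] = right_cont_process_measurable[OF X rc]
  have "(\<lambda>\<omega>. \<integral>\<^sup>+u. ennreal (norm (X \<omega> (max 0 u)) powr \<beta>) * indicator {0..s} u \<partial>lborel) \<in> borel_measurable M"
    by measurable
  moreover have "clock \<beta> (X \<omega>) s = (\<integral>\<^sup>+u. ennreal (norm (X \<omega> (max 0 u)) powr \<beta>) * indicator {0..s} u \<partial>lborel)"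
    if "\<omega> \<in> space M" for \<omega>
    unfolding clock_def using rc[OF that]
    by (subst emeasure_clock_measure) (auto simp: indicator_def max_def intro!: nn_integral_cong)
  ultimately show ?thesis by (subst measurable_cong) auto
qed

text \<open>The value is that of the jointly measurable process at the random time \<open>T\<close>.
  Where the clock never exceeds \<open>t\<close> the infimum is over the empty set, so
  \<open>T\<close> is given the value 0 there.\<close>

lemma time_change_process_measurable:
  fixes X :: "'w \<Rightarrow> real \<Rightarrow> 'a::euclidean_space"
  assumes X: "\<And>u. u \<ge> 0 \<Longrightarrow> (\<lambda>\<omega>. X \<omega> u) \<in> borel_measurable M"
    and rc: "\<And>\<omega>. \<omega> \<in> space M \<Longrightarrow> right_cont (X \<omega>)"
    and t: "0 \<le> t"
  shows "(\<lambda>\<omega>. time_change \<beta> (X \<omega>) t) \<in> borel_measurable M"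
proof -
  note [measurable] = right_cont_process_measurable[OF X rc] clock_process_measurable[OF X rc]
  have tot [measurable]: "(\<lambda>\<omega>. clock_total \<beta> (X \<omega>)) \<in> borel_measurable M"
    unfolding clock_total_SUP by measurable
  define T where "T \<omega> = (if ennreal t < clock_total \<beta> (X \<omega>) then clock_inv \<beta> (X \<omega>) t else 0)" for \<omega>
  have T [measurable]: "T \<in> borel_measurable M"
  proof (rule borel_measurableI_less)
    fix a :: real
    \<comment> \<open>By monotonicity of the clock, a rational just to the right of a witness is
      again a witness, which leaves a countable condition.\<close>
    have "T \<omega> < a \<longleftrightarrow> (if ennreal t < clock_total \<beta> (X \<omega>)
        then \<exists>q::rat. 0 < real_of_rat q \<and> real_of_rat q < a \<and> ennreal t < clock \<beta> (X \<omega>) (real_of_rat q)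
        else 0 < a)" if "\<omega> \<in> space M" for \<omega>
    proof (cases "ennreal t < clock_total \<beta> (X \<omega>)")
      case True
      let ?S = "{s. 0 < s \<and> clock \<beta> (X \<omega>) s > ennreal t}"
      have "bdd_below ?S" by (auto intro: bdd_belowI[of _ 0])
      then have "T \<omega> < a \<longleftrightarrow> (\<exists>s\<in>?S. s < a)"
        using True clock_inv_set[OF t True] by (simp add: T_def clock_inv_def cInf_less_iff)
      also have "\<dots> \<longleftrightarrow> (\<exists>q::rat. 0 < real_of_rat q \<and> real_of_rat q < a \<and> ennreal t < clock \<beta> (X \<omega>) (real_of_rat q))"
      proof
        assume "\<exists>s\<in>?S. s < a"
        then obtain s where s: "0 < s" "ennreal t < clock \<beta> (X \<omega>) s" "s < a" by auto
        then obtain q where q: "s < real_of_rat q" "real_of_rat q < a" using of_rat_dense by blast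
        then show "\<exists>q::rat. 0 < real_of_rat q \<and> real_of_rat q < a \<and> ennreal t < clock \<beta> (X \<omega>) (real_of_rat q)"
          using s clock_mono[of s "real_of_rat q" \<beta> "X \<omega>"]
          by (meson less_trans less_le_trans less_imp_le)
      qed (auto simp del: zero_less_of_rat_iff)
      finally show ?thesis using True by simp
    qed (simp add: T_def)
    then have "{\<omega> \<in> space M. T \<omega> < a} = {\<omega> \<in> space M. (if ennreal t < clock_total \<beta> (X \<omega>)
        then \<exists>q::rat. 0 < real_of_rat q \<and> real_of_rat q < a \<and> ennreal t < clock \<beta> (X \<omega>) (real_of_rat q)
        else 0 < a)}" by blast
    also have "\<dots> \<in> sets M" by measurable
    finally show "{\<omega> \<in> space M. T \<omega> < a} \<in> sets M" .
  qed
  have "(\<lambda>\<omega>. if ennreal t < clock_total \<beta> (X \<omega>) then X \<omega> (max 0 (T \<omega>)) else 0) \<in> borel_measurable M"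
    by measurable
  moreover have "time_change \<beta> (X \<omega>) t = (if ennreal t < clock_total \<beta> (X \<omega>) then X \<omega> (max 0 (T \<omega>)) else 0)" for \<omega>
    using clock_inv_nonneg[OF t, of \<beta> "X \<omega>"] by (simp add: time_change_def T_def max_def)
  ultimately show ?thesis by simp
qed

lemma restrict_process_measurable:
  fixes X :: "'w \<Rightarrow> real \<Rightarrow> 'a::topological_space"
  assumes X: "\<And>u. u \<ge> 0 \<Longrightarrow> (\<lambda>\<omega>. X \<omega> u) \<in> borel_measurable M"
  shows "(\<lambda>\<omega>. restrict (X \<omega>) {0..}) \<in> M \<rightarrow>\<^sub>M PiM {0..} (\<lambda>_. borel)"
  using X by (intro measurable_restrict) auto

lemma law_cong:
  assumes "\<And>\<omega> t. \<omega> \<in> space M \<Longrightarrow> 0 \<le> t \<Longrightarrow> X \<omega> t = Y \<omega> t"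
  shows "law M X = law M Y"
  unfolding law_def using assms by (intro distr_cong) (auto simp: fun_eq_iff)

lemma law_cong_AE:
  fixes X Y :: "'w \<Rightarrow> real \<Rightarrow> 'a::topological_space"
  assumes "\<And>u. u \<ge> 0 \<Longrightarrow> (\<lambda>\<omega>. X \<omega> u) \<in> borel_measurable M"
    and "\<And>u. u \<ge> 0 \<Longrightarrow> (\<lambda>\<omega>. Y \<omega> u) \<in> borel_measurable M"
    and "AE \<omega> in M. \<forall>t\<ge>0. X \<omega> t = Y \<omega> t"
  shows "law M X = law M Y"
  unfolding law_def
proof (rule distr_cong_AE)
  show "AE \<omega> in M. restrict (X \<omega>) {0..} = restrict (Y \<omega>) {0..}"
    using assms(3) by eventually_elim (auto simp: fun_eq_iff)
qed (use assms in \<open>auto intro: restrict_process_measurable\<close>)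

lemma law_map:
  fixes X :: "'w \<Rightarrow> real \<Rightarrow> 'a::topological_space" and Y :: "'v \<Rightarrow> real \<Rightarrow> 'a"
    and \<phi> :: "'a \<Rightarrow> 'b::topological_space"
  assumes X: "\<And>u. u \<ge> 0 \<Longrightarrow> (\<lambda>\<omega>. X \<omega> u) \<in> borel_measurable M"
    and Y: "\<And>u. u \<ge> 0 \<Longrightarrow> (\<lambda>\<omega>. Y \<omega> u) \<in> borel_measurable N"
    and \<phi>: "\<phi> \<in> borel_measurable borel"
    and eq: "law M X = law N Y"
  shows "law M (\<lambda>\<omega> t. \<phi> (X \<omega> t)) = law N (\<lambda>\<omega> t. \<phi> (Y \<omega> t))"
proof -
  let ?g = "\<lambda>w. restrict (\<lambda>t. \<phi> (w t)) {0..}"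
  have g: "?g \<in> PiM {0..} (\<lambda>_. borel) \<rightarrow>\<^sub>M PiM {0..} (\<lambda>_::real. borel)"
    by (intro restrict_process_measurable measurable_compose[OF _ \<phi>] measurable_component_singleton) simp
  have "distr (law M X) (PiM {0..} (\<lambda>_. borel)) ?g = law M (\<lambda>\<omega> t. \<phi> (X \<omega> t))"
    unfolding law_def
    by (subst distr_distr[OF g restrict_process_measurable[OF X]])
      (auto simp: fun_eq_iff intro!: distr_cong)
  moreover have "distr (law N Y) (PiM {0..} (\<lambda>_. borel)) ?g = law N (\<lambda>\<omega> t. \<phi> (Y \<omega> t))"
    unfolding law_def
    by (subst distr_distr[OF g restrict_process_measurable[OF Y]])
      (auto simp: fun_eq_iff intro!: distr_cong)
  ultimately show ?thesis using eq by simp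
qed

text \<open>The time change is not measurable on the full product space, only on its trace on the
  right-continuous paths; that set need not be measurable, but the law passes to the trace.\<close>

lemma law_right_cont_trace:
  fixes X :: "'w \<Rightarrow> real \<Rightarrow> 'a::euclidean_space" and \<beta> :: real
  defines "S \<equiv> PiM {0..} (\<lambda>_. borel) :: (real \<Rightarrow> 'a) measure"
  defines "R \<equiv> restrict_space S (Collect right_cont)"
  assumes X: "\<And>u. u \<ge> 0 \<Longrightarrow> (\<lambda>\<omega>. X \<omega> u) \<in> borel_measurable M"
    and rX: "\<And>\<omega>. \<omega> \<in> space M \<Longrightarrow> right_cont (X \<omega>)"
  shows "distr (distr M R (\<lambda>\<omega>. restrict (X \<omega>) {0..})) S (\<lambda>w. restrict (time_change \<beta> w) {0..})
      = law M (\<lambda>\<omega>. time_change \<beta> (X \<omega>))"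
    and "A \<in> sets S \<Longrightarrow>
      emeasure (distr M R (\<lambda>\<omega>. restrict (X \<omega>) {0..})) (A \<inter> Collect right_cont) = emeasure (law M X) A"
proof -
  have g: "(\<lambda>w. restrict (time_change \<beta> w) {0..}) \<in> R \<rightarrow>\<^sub>M S"
    unfolding S_def
  proof (intro restrict_process_measurable time_change_process_measurable)
    fix u :: real assume "u \<ge> 0"
    then show "(\<lambda>w. w u) \<in> borel_measurable R"
      unfolding R_def S_def by (intro measurable_restrict_space1 measurable_component_singleton) auto
  qed (auto simp: R_def space_restrict_space)
  have f: "(\<lambda>\<omega>. restrict (X \<omega>) {0..}) \<in> M \<rightarrow>\<^sub>M R"
    unfolding R_def S_def using rX
    by (intro measurable_restrict_space2 restrict_process_measurable[OF X]) auto
  show "distr (distr M R (\<lambda>\<omega>. restrict (X \<omega>) {0..})) S (\<lambda>w. restrict (time_change \<beta> w) {0..})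
      = law M (\<lambda>\<omega>. time_change \<beta> (X \<omega>))"
    unfolding law_def
    by (subst distr_distr[OF g f]) (auto simp: S_def fun_eq_iff intro!: distr_cong time_change_cong)
  assume A: "A \<in> sets S"
  then have "A \<inter> Collect right_cont \<in> sets R" by (auto simp: R_def sets_restrict_space)
  then show "emeasure (distr M R (\<lambda>\<omega>. restrict (X \<omega>) {0..})) (A \<inter> Collect right_cont) = emeasure (law M X) A"
    using A rX f restrict_process_measurable[OF X] unfolding law_def S_def
    by (auto simp: emeasure_distr intro!: arg_cong2[where f=emeasure])
qed

lemma law_time_change:
  fixes X :: "'w \<Rightarrow> real \<Rightarrow> 'a::euclidean_space" and Y :: "'v \<Rightarrow> real \<Rightarrow> 'a"
  assumes X: "\<And>u. u \<ge> 0 \<Longrightarrow> (\<lambda>\<omega>. X \<omega> u) \<in> borel_measurable M"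
    and rX: "\<And>\<omega>. \<omega> \<in> space M \<Longrightarrow> right_cont (X \<omega>)"
    and Y: "\<And>u. u \<ge> 0 \<Longrightarrow> (\<lambda>\<omega>. Y \<omega> u) \<in> borel_measurable N"
    and rY: "\<And>\<omega>. \<omega> \<in> space N \<Longrightarrow> right_cont (Y \<omega>)"
    and eq: "law M X = law N Y"
  shows "law M (\<lambda>\<omega>. time_change \<beta> (X \<omega>)) = law N (\<lambda>\<omega>. time_change \<beta> (Y \<omega>))"
proof -
  let ?S = "PiM {0..} (\<lambda>_. borel) :: (real \<Rightarrow> 'a) measure"
  let ?D = "Collect right_cont :: (real \<Rightarrow> 'a) set"
  let ?R = "restrict_space ?S ?D"
  have "distr M ?R (\<lambda>\<omega>. restrict (X \<omega>) {0..}) = distr N ?R (\<lambda>\<omega>. restrict (Y \<omega>) {0..})"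
  proof (rule measure_eqI)
    fix B assume "B \<in> sets (distr M ?R (\<lambda>\<omega>. restrict (X \<omega>) {0..}))"
    \<comment> \<open>Every trace set has the form \<open>A \<inter> ?D\<close>, and its mass is
      that of \<open>A\<close> under the law; equality of laws thus carries over to the
      trace.\<close>
    then obtain A where A: "B = A \<inter> ?D" "A \<in> sets ?S" by (auto simp: sets_restrict_space)
    show "emeasure (distr M ?R (\<lambda>\<omega>. restrict (X \<omega>) {0..})) B = emeasure (distr N ?R (\<lambda>\<omega>. restrict (Y \<omega>) {0..})) B"
      unfolding A(1) using A(2) law_right_cont_trace(2)[OF X rX] law_right_cont_trace(2)[OF Y rY] eq by simp
  qed simp
  then show ?thesis
    using law_right_cont_trace(1)[OF X rX, of \<beta>] law_right_cont_trace(1)[OF Y rY, of \<beta>] by simp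
qed

section \<open>The test function on the states of the MAP\<close>

lemma eexp_simps [simp]: "eexp (ereal r) = exp r" "eexp (- \<infinity>) = 0" "eexp \<infinity> = 0"
  by (simp_all add: eexp_def)

lemma eexp_measurable [measurable]: "eexp \<in> borel_measurable borel"
proof -
  have "eexp = (\<lambda>y. if \<bar>y\<bar> = \<infinity> then 0 else exp (real_of_ereal y))"
    by (rule ext) (auto simp: eexp_def split: ereal.splits)
  moreover have "(\<lambda>y. if \<bar>y\<bar> = \<infinity> then 0 else exp (real_of_ereal y)) \<in> borel_measurable borel"
    by measurable
  ultimately show ?thesis by (simp only:)
qed

text \<open>The punctured neighbourhood filter of a finite extended real is the image of the one on
  the reals.\<close>

lemma isCont_ereal_comp:
  fixes g :: "ereal \<Rightarrow> 'a::topological_space"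
  assumes "isCont (\<lambda>x. g (ereal x)) r"
  shows "isCont g (ereal r)"
  using assms unfolding isCont_def unfolding at_ereal filterlim_filtermap .

text \<open>This is \<open>e\<close> to the power \<open>-\<bar>\<xi>\<bar>\<close>: positive on
  living states, zero at the cemetery, at most 1, and vanishing at both ends of the line, as a
  Feller test function must.\<close>

definition peak :: "ereal \<times> 'b \<Rightarrow> real" where
  "peak p = eexp (- \<bar>fst p\<bar>)"

lemma fst_borel [measurable]: "fst \<in> borel_measurable (borel :: (ereal \<times> (real^'n)) measure)"
  by (intro borel_measurable_continuous_onI continuous_intros)

lemma snd_borel [measurable]: "snd \<in> borel_measurable (borel :: (ereal \<times> (real^'n)) measure)"
  by (intro borel_measurable_continuous_onI continuous_intros)

lemma peak_measurable [measurable]: "peak \<in> borel_measurable (borel :: (ereal \<times> (real^'n)) measure)"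
  unfolding peak_def[abs_def] by measurable

lemma peak_bounds: "0 \<le> peak p" "peak p \<le> 1"
  by (cases "fst p"; simp add: peak_def)+

lemma MAP_states_iff: "p \<in> MAP_states \<longleftrightarrow> \<bar>fst p\<bar> \<noteq> \<infinity> \<and> norm (snd p) = 1"
proof -
  have "\<bar>fst p\<bar> \<noteq> \<infinity> \<longleftrightarrow> (\<exists>x. fst p = ereal x)" by (cases "fst p") auto
  then show ?thesis by (cases p) (auto simp: MAP_states_def)
qed

lemma isCont_peak: "p \<in> MAP_states \<Longrightarrow> isCont peak p"
proof -
  assume "p \<in> MAP_states"
  then obtain x where x: "fst p = ereal x" by (auto simp: MAP_states_def)
  have "isCont (\<lambda>y. eexp (- \<bar>y\<bar>)) (ereal x)"
    by (rule isCont_ereal_comp) (auto intro!: continuous_intros)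
  then show ?thesis
    unfolding peak_def[abs_def] using x by (intro isCont_o2[where f=fst and g="\<lambda>y. eexp (- \<bar>y\<bar>)"]) (auto intro: continuous_intros)
qed

lemma C0_on_peak: "C0_on (MAP_states :: (ereal \<times> (real^'n)) set) peak"
  unfolding C0_on_def
proof (intro conjI allI impI)
  show "continuous_on MAP_states (peak :: ereal \<times> (real^'n) \<Rightarrow> real)"
    by (intro continuous_at_imp_continuous_on ballI isCont_peak)
  fix e :: real assume e: "e > 0"
  \<comment> \<open>The value falls below \<open>e\<close> as soon as the level exceeds
    \<open>- ln e\<close> in modulus; taking \<open>\<bar>ln e\<bar>\<close> also covers
    \<open>e > 1\<close>.\<close>
  let ?K = "(ereal ` {-\<bar>ln e\<bar>..\<bar>ln e\<bar>}) \<times> (sphere 0 1 :: (real^'n) set)"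
  have 1: "compact ?K"
    by (intro compact_Times compact_continuous_image continuous_on_ereal continuous_on_id) auto
  have 2: "?K \<subseteq> MAP_states" by (auto simp: MAP_states_def)
  have 3: "\<bar>peak y\<bar> < e" if "y \<in> MAP_states - ?K" for y :: "ereal \<times> (real^'n)"
  proof -
    from that obtain x \<theta> where y: "y = (ereal x, \<theta>)" "\<theta> \<in> sphere 0 1" by (auto simp: MAP_states_def)
    then have "x \<notin> {-\<bar>ln e\<bar>..\<bar>ln e\<bar>}" using that by auto
    then have "- \<bar>x\<bar> < ln e" by auto
    then have "exp (- \<bar>x\<bar>) < e" using e by (metis exp_less_mono exp_ln)
    then show ?thesis by (simp add: y peak_def)
  qed
  show "\<exists>K :: (ereal \<times> (real^'n)) set. compact K \<and> K \<subseteq> MAP_states \<and> (\<forall>y\<in>MAP_states - K. \<bar>peak y\<bar> < e)"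
    using 1 2 3 by blast
qed

lemma nat_filt_measurable:
  assumes "0 \<le> u" "u \<le> t"
  shows "(\<lambda>\<omega>. X \<omega> u) \<in> borel_measurable (nat_filt M X t)"
proof -
  let ?G = "{(\<lambda>\<omega>. X \<omega> u) -` A \<inter> space M | u A. 0 \<le> u \<and> u \<le> t \<and> A \<in> sets borel}"
  have sub: "?G \<subseteq> Pow (space M)" by auto
  have sp: "space (nat_filt M X t) = space M" by (simp add: nat_filt_def space_measure_of[OF sub])
  show ?thesis
  proof (rule measurableI)
    fix A :: "'b set" assume "A \<in> sets borel"
    then have "(\<lambda>\<omega>. X \<omega> u) -` A \<inter> space M \<in> ?G" using assms by blast
    then show "(\<lambda>\<omega>. X \<omega> u) -` A \<inter> space (nat_filt M X t) \<in> sets (nat_filt M X t)"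
      unfolding sp by (simp add: nat_filt_def sets_measure_of[OF sub] sigma_sets.Basic)
  qed simp
qed

lemma space_nat_filt: "space (nat_filt M X t) = space M"
  unfolding nat_filt_def by (subst space_measure_of) auto

section \<open>Path properties of the MAP\<close>

context
  fixes \<xi> :: "'v \<Rightarrow> real \<Rightarrow> ereal" and \<Theta> :: "'v \<Rightarrow> real \<Rightarrow> real^'n"
    and Pb :: "ereal \<times> (real^'n) \<Rightarrow> 'v measure"
  assumes feller: "feller_process MAP_states {(-\<infinity>, 0)} Pb (\<lambda>\<omega> t. (\<xi> \<omega> t, \<Theta> \<omega> t))"
begin

lemma MAP_prob_space: "z \<in> MAP_states \<Longrightarrow> prob_space (Pb z)"
  using feller unfolding feller_process_def by (elim conjE) blast

lemma MAP_measurable: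
  assumes "z \<in> MAP_states" "0 \<le> t"
  shows "(\<lambda>\<omega>. (\<xi> \<omega> t, \<Theta> \<omega> t)) \<in> borel_measurable (Pb z)"
proof -
  have "\<forall>x\<in>MAP_states. \<forall>t\<ge>0. (\<lambda>\<omega>. (\<xi> \<omega> t, \<Theta> \<omega> t)) \<in> borel_measurable (Pb x)"
    using feller unfolding feller_process_def by (elim conjE) assumption
  with assms show ?thesis by blast
qed

lemma MAP_state:
  assumes "z \<in> MAP_states" "\<omega> \<in> space (Pb z)" "0 \<le> t"
  shows "(\<exists>x. \<xi> \<omega> t = ereal x \<and> norm (\<Theta> \<omega> t) = 1) \<or> \<xi> \<omega> t = -\<infinity> \<and> \<Theta> \<omega> t = 0"
proof -
  have "\<forall>x\<in>MAP_states. \<forall>\<omega>\<in>space (Pb x). \<forall>t\<ge>0. (\<xi> \<omega> t, \<Theta> \<omega> t) \<in> MAP_states \<union> {(-\<infinity>, 0)}"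
    using feller unfolding feller_process_def by (elim conjE) assumption
  with assms have "(\<xi> \<omega> t, \<Theta> \<omega> t) \<in> MAP_states \<union> {(-\<infinity>, 0)}" by blast
  then show ?thesis by (auto simp: MAP_states_def)
qed

lemma MAP_absorbed:
  assumes "z \<in> MAP_states" "\<omega> \<in> space (Pb z)" "0 \<le> t" "t \<le> s" "\<Theta> \<omega> t = 0"
  shows "\<xi> \<omega> s = -\<infinity>" "\<Theta> \<omega> s = 0" "\<xi> \<omega> t = -\<infinity>"
proof -
  have *: "\<forall>x\<in>MAP_states. \<forall>\<omega>\<in>space (Pb x). \<forall>t\<ge>0. \<forall>s\<ge>0. (\<xi> \<omega> t, \<Theta> \<omega> t) \<in> {(-\<infinity>, 0)} \<longrightarrow>
      (\<xi> \<omega> (t + s), \<Theta> \<omega> (t + s)) = (\<xi> \<omega> t, \<Theta> \<omega> t)"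
    using feller unfolding feller_process_def by (elim conjE) assumption
  show x: "\<xi> \<omega> t = -\<infinity>" using MAP_state[OF assms(1-3)] assms(5) by auto
  have "0 \<le> s - t" using assms by simp
  then have "(\<xi> \<omega> (t + (s - t)), \<Theta> \<omega> (t + (s - t))) = (\<xi> \<omega> t, \<Theta> \<omega> t)"
    using * assms x by blast
  then show "\<xi> \<omega> s = -\<infinity>" "\<Theta> \<omega> s = 0" using x assms by auto
qed

text \<open>Continuity is required at living states only, because the path is constant once it has
  entered the cemetery. This allows maps that are discontinuous at infinite levels.\<close>

lemma MAP_right_cont_map:
  fixes g :: "ereal \<times> (real^'n) \<Rightarrow> 'c::topological_space"
  assumes z: "z \<in> MAP_states" "\<omega> \<in> space (Pb z)"
    and g: "\<And>p. p \<in> MAP_states \<Longrightarrow> isCont g p"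
  shows "right_cont (\<lambda>t. g (\<xi> \<omega> t, \<Theta> \<omega> t))"
  unfolding right_cont_def
proof (intro allI impI)
  fix t :: real assume t: "0 \<le> t"
  have "\<forall>x\<in>MAP_states. \<forall>\<omega>\<in>space (Pb x). cadlag (\<lambda>t. (\<xi> \<omega> t, \<Theta> \<omega> t))"
    using feller unfolding feller_process_def by (elim conjE) assumption
  then have "continuous (at_right t) (\<lambda>t. (\<xi> \<omega> t, \<Theta> \<omega> t))" using z t by (auto simp: cadlag_def)
  then have l: "((\<lambda>t. (\<xi> \<omega> t, \<Theta> \<omega> t)) \<longlongrightarrow> (\<xi> \<omega> t, \<Theta> \<omega> t)) (at_right t)"
    by (simp add: continuous_within)
  show "((\<lambda>t. g (\<xi> \<omega> t, \<Theta> \<omega> t)) \<longlongrightarrow> g (\<xi> \<omega> t, \<Theta> \<omega> t)) (at_right t)"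
  proof (cases "\<Theta> \<omega> t = 0")
    case True
    then have "(\<xi> \<omega> u, \<Theta> \<omega> u) = (\<xi> \<omega> t, \<Theta> \<omega> t)" if "t < u" for u
      using MAP_absorbed[OF z t _ True, of u] that by auto
    then show ?thesis
      by (intro tendsto_eventually) (auto simp: eventually_at_right_field intro: exI[of _ "t + 1"])
  next
    case False
    then have "(\<xi> \<omega> t, \<Theta> \<omega> t) \<in> MAP_states" using MAP_state[OF z t] by (auto simp: MAP_states_iff)
    from isCont_tendsto_compose[OF g[OF this] l] show ?thesis .
  qed
qed

section \<open>No explosion of the level before absorption\<close>

abbreviation (input) SG :: "real \<Rightarrow> ereal \<times> (real^'n) \<Rightarrow> real" where
  "SG r \<equiv> semigrp Pb (\<lambda>\<omega> t. (\<xi> \<omega> t, \<Theta> \<omega> t)) {(-\<infinity>, 0)} r peak"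

lemma SG_le_1:
  assumes "p \<in> MAP_states" "0 \<le> r" shows "SG r p \<le> 1"
proof -
  interpret prob_space "Pb p" using MAP_prob_space assms by blast
  have "(\<integral>\<omega>. peak (\<xi> \<omega> r, \<Theta> \<omega> r) \<partial>Pb p) \<le> (\<integral>\<omega>. 1 \<partial>Pb p)"
    by (rule integral_mono_AE') (auto simp: peak_bounds)
  then show ?thesis by (simp add: semigrp_def prob_space)
qed

text \<open>The semigroup image is small off some compact set of living states. The first
  coordinates of that set attain a maximum, which is finite because living states have finite
  levels; any level above it serves as \<open>L\<close>.\<close>

lemma SG_decay:
  assumes "0 \<le> r" "0 < e"
  shows "\<exists>L. \<forall>p\<in>MAP_states. ereal L \<le> fst p \<longrightarrow> SG r p \<le> e"
proof -
  have "\<forall>f. C0_on MAP_states f \<and> (\<forall>k\<in>{(-\<infinity>, 0)}. f k = 0) \<longrightarrow>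
    (\<forall>t\<ge>0. C0_on MAP_states (semigrp Pb (\<lambda>\<omega> t. (\<xi> \<omega> t, \<Theta> \<omega> t)) {(-\<infinity>, 0)} t f)) \<and>
    (\<forall>y\<in>MAP_states. ((\<lambda>t. semigrp Pb (\<lambda>\<omega> t. (\<xi> \<omega> t, \<Theta> \<omega> t)) {(-\<infinity>, 0)} t f y) \<longlongrightarrow> f y) (at_right 0))"
    using feller unfolding feller_process_def by (elim conjE) assumption
  moreover have "peak (-\<infinity>, 0 :: real^'n) = 0" by (simp add: peak_def)
  ultimately have "C0_on MAP_states (SG r)" using C0_on_peak assms by blast
  then obtain K where K: "compact K" "K \<subseteq> MAP_states" "\<forall>y\<in>MAP_states - K. \<bar>SG r y\<bar> < e"
    using assms unfolding C0_on_def by blast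
  obtain L where L: "\<And>p. p \<in> K \<Longrightarrow> fst p < ereal L"
  proof (cases "K = {}")
    case False
    then obtain m where m: "m \<in> fst ` K" "\<And>y. y \<in> fst ` K \<Longrightarrow> y \<le> m"
      using compact_attains_sup[OF compact_continuous_image[OF continuous_on_fst[OF continuous_on_id] K(1)]]
      by blast
    from m(1) obtain p where p: "p \<in> K" "m = fst p" by blast
    have "p \<in> MAP_states" using p(1) K(2) by (rule rev_subsetD)
    then have "\<bar>m\<bar> \<noteq> \<infinity>" unfolding p(2) by (simp only: MAP_states_iff not_False_eq_True)
    then obtain a where a: "m = ereal a" by (cases m) auto
    have "fst p < ereal (a + 1)" if "p \<in> K" for p
    proof -
      have "fst p \<le> ereal a" using m(2)[of "fst p"] that a by blast
      also have "\<dots> < ereal (a + 1)" by simp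
      finally show ?thesis .
    qed
    then show ?thesis by (rule that)
  qed (use that in auto)
  have "SG r p \<le> e" if "p \<in> MAP_states" "ereal L \<le> fst p" for p
  proof -
    have "p \<notin> K" using L[of p] that by auto
    from bspec[OF K(3) DiffI[OF that(1) this]] show ?thesis by linarith
  qed
  then show ?thesis by blast
qed

text \<open>The Markov property at time \<open>q\<close>, tested against the indicator of an event
  of the past.\<close>

lemma peak_markov:
  assumes z: "z \<in> MAP_states" and qr: "0 \<le> q" "0 \<le> r"
    and A: "A \<in> sets (nat_filt (Pb z) (\<lambda>\<omega> t. (\<xi> \<omega> t, \<Theta> \<omega> t)) q)" "A \<in> sets (Pb z)"
    and e: "0 \<le> e" "\<And>\<omega>. \<omega> \<in> A \<Longrightarrow> SG r (\<xi> \<omega> q, \<Theta> \<omega> q) \<le> e"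
  shows "(\<integral>\<^sup>+\<omega>. indicator A \<omega> * ennreal (peak (\<xi> \<omega> (q + r), \<Theta> \<omega> (q + r))) \<partial>Pb z) \<le> ennreal e * emeasure (Pb z) A"
proof -
  interpret prob_space "Pb z" using MAP_prob_space z by blast
  have [measurable]: "(\<lambda>\<omega>. peak (\<xi> \<omega> (q + r), \<Theta> \<omega> (q + r))) \<in> borel_measurable (Pb z)"
    using measurable_compose[OF MAP_measurable[OF z] peak_measurable] qr by auto
  note A(2)[measurable]
  have "\<forall>x\<in>MAP_states. \<forall>s\<ge>0. \<forall>t\<ge>0. \<forall>(f :: ereal \<times> (real^'n) \<Rightarrow> real) (g :: 'v \<Rightarrow> real).
          f \<in> borel_measurable borel \<and> bounded (range f) \<and> (\<forall>k\<in>{(-\<infinity>, 0)}. f k = 0) \<and>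
          g \<in> borel_measurable (nat_filt (Pb x) (\<lambda>\<omega> t. (\<xi> \<omega> t, \<Theta> \<omega> t)) t) \<and> bounded (range g) \<longrightarrow>
          (\<integral>\<omega>. g \<omega> * f (\<xi> \<omega> (t + s), \<Theta> \<omega> (t + s)) \<partial>Pb x) =
          (\<integral>\<omega>. g \<omega> * semigrp Pb (\<lambda>\<omega> t. (\<xi> \<omega> t, \<Theta> \<omega> t)) {(-\<infinity>, 0)} s f (\<xi> \<omega> t, \<Theta> \<omega> t) \<partial>Pb x)"
    using feller unfolding feller_process_def by (elim conjE) assumption
  moreover have "bounded (range (peak :: ereal \<times> (real^'n) \<Rightarrow> real))"
    by (rule boundedI[of _ 1]) (auto simp: peak_bounds abs_of_nonneg)
  moreover have "bounded (range (indicator A :: 'v \<Rightarrow> real))"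
    by (rule boundedI[of _ 1]) (auto simp: indicator_def)
  moreover have "(indicator A :: 'v \<Rightarrow> real) \<in> borel_measurable (nat_filt (Pb z) (\<lambda>\<omega> t. (\<xi> \<omega> t, \<Theta> \<omega> t)) q)"
    using A(1) by simp
  moreover have "peak (-\<infinity>, 0 :: real^'n) = 0" by (simp add: peak_def)
  ultimately have eq: "(\<integral>\<omega>. indicator A \<omega> * peak (\<xi> \<omega> (q + r), \<Theta> \<omega> (q + r)) \<partial>Pb z)
      = (\<integral>\<omega>. indicator A \<omega> * SG r (\<xi> \<omega> q, \<Theta> \<omega> q) \<partial>Pb z)"
    using z qr peak_measurable by (elim ballE[of _ _ z]) (auto simp del: split_paired_All)
  have int: "integrable (Pb z) (\<lambda>\<omega>. indicator A \<omega> * peak (\<xi> \<omega> (q + r), \<Theta> \<omega> (q + r)))"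
    by (rule integrable_const_bound[of _ 1]) (auto simp: indicator_def peak_bounds)
  have "(\<integral>\<^sup>+\<omega>. indicator A \<omega> * ennreal (peak (\<xi> \<omega> (q + r), \<Theta> \<omega> (q + r))) \<partial>Pb z)
      = (\<integral>\<^sup>+\<omega>. ennreal (indicator A \<omega> * peak (\<xi> \<omega> (q + r), \<Theta> \<omega> (q + r))) \<partial>Pb z)"
    by (intro nn_integral_cong) (auto simp: indicator_def)
  also have "\<dots> = ennreal (\<integral>\<omega>. indicator A \<omega> * SG r (\<xi> \<omega> q, \<Theta> \<omega> q) \<partial>Pb z)"
    unfolding eq[symmetric] by (rule nn_integral_eq_integral[OF int]) (auto simp: peak_bounds)
  also have "\<dots> \<le> ennreal (\<integral>\<omega>. e * indicator A \<omega> \<partial>Pb z)"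
  proof (intro ennreal_leI integral_mono_AE')
    show "integrable (Pb z) (\<lambda>\<omega>. e * indicator A \<omega>)"
      by (intro integrable_mult_right integrable_real_indicator) (auto simp: emeasure_eq_measure)
  qed (use e in \<open>auto simp: indicator_def\<close>)
  also have "\<dots> = ennreal e * emeasure (Pb z) A"
    using e(1) by (simp add: ennreal_mult emeasure_eq_measure)
  finally show ?thesis .
qed

lemma MAP_component_measurable:
  assumes "z \<in> MAP_states" "0 \<le> t"
  shows "(\<lambda>\<omega>. \<xi> \<omega> t) \<in> borel_measurable (Pb z)" "(\<lambda>\<omega>. \<Theta> \<omega> t) \<in> borel_measurable (Pb z)"
  using measurable_compose[OF MAP_measurable[OF assms] fst_borel]
    measurable_compose[OF MAP_measurable[OF assms] snd_borel] by simp_all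

lemma peak_process_measurable:
  assumes "z \<in> MAP_states"
  shows "(\<lambda>(\<omega>, u). peak (\<xi> \<omega> (max 0 u), \<Theta> \<omega> (max 0 u))) \<in> borel_measurable (Pb z \<Otimes>\<^sub>M borel)"
  by (rule right_cont_process_measurable[where X="\<lambda>\<omega> u. peak (\<xi> \<omega> u, \<Theta> \<omega> u)"])
    (use measurable_compose[OF MAP_measurable[OF assms] peak_measurable]
      MAP_right_cont_map[OF assms _ isCont_peak] in auto)

text \<open>Stopping at the first time in \<open>F\<close> at which \<open>\<xi>\<close> reaches \<open>L\<close>: the process then
  restarts from a high level, and \<open>D r\<close> is the expected value of \<open>peak\<close> a time \<open>r\<close> later.\<close>

lemma high_level_bound:
  assumes z: "z \<in> MAP_states" and s: "0 \<le> s" and F: "finite F" "F \<subseteq> {0..s}"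
  shows "\<exists>D. D \<in> borel_measurable borel \<and>
    (\<forall>r\<ge>0. \<forall>e\<ge>0. (\<forall>p\<in>MAP_states. ereal L \<le> fst p \<longrightarrow> SG r p \<le> e) \<longrightarrow> D r \<le> ennreal e) \<and>
    (\<integral>\<^sup>+\<omega>. indicator {\<omega>. \<exists>q\<in>F. ereal L \<le> \<xi> \<omega> q} \<omega> *
        (\<integral>\<^sup>+v\<in>{s..s+1}. ennreal (peak (\<xi> \<omega> (max 0 v), \<Theta> \<omega> (max 0 v))) \<partial>lborel) \<partial>Pb z)
    \<le> (\<integral>\<^sup>+r\<in>{0..s+1}. D r \<partial>lborel)"
proof -
  interpret P: prob_space "Pb z" using MAP_prob_space z by blast
  interpret pair_sigma_finite "Pb z" "lborel :: real measure" ..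
  let ?X = "\<lambda>\<omega> t. (\<xi> \<omega> t, \<Theta> \<omega> t)"
  define Y where "Y \<omega> u = ennreal (peak (?X \<omega> (max 0 u)))" for \<omega> u
  have Y [measurable]: "(\<lambda>(\<omega>, u). Y \<omega> u) \<in> borel_measurable (Pb z \<Otimes>\<^sub>M borel)"
    using peak_process_measurable[OF z] unfolding Y_def by measurable
  have Yq [measurable]: "(\<lambda>(\<omega>, u). Y \<omega> (q + u)) \<in> borel_measurable (Pb z \<Otimes>\<^sub>M borel)" for q
    by measurable
  have Y1 [measurable]: "(\<lambda>u. Y \<omega> (q + u)) \<in> borel_measurable borel" if "\<omega> \<in> space (Pb z)" for \<omega> q
    using measurable_compose[OF measurable_Pair1'[OF that] Yq[of q]] by simp
  have Y1' [measurable]: "Y \<omega> \<in> borel_measurable borel" if "\<omega> \<in> space (Pb z)" for \<omega>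
    using Y1[OF that, of 0] by simp
  \<comment> \<open>On \<open>A q\<close> the time \<open>q\<close> is the first in \<open>F\<close>
    at which the level is reached. These events are disjoint and each is known at time
    \<open>q\<close>.\<close>
  define A where "A q = {\<omega> \<in> space (Pb z). ereal L \<le> \<xi> \<omega> q \<and> (\<forall>p\<in>F. p < q \<longrightarrow> \<xi> \<omega> p < ereal L)}" for q
  have q0: "0 \<le> q" "q \<le> s" if "q \<in> F" for q using that F by auto
  have Anat: "A q \<in> sets (nat_filt (Pb z) ?X q)" if q: "q \<in> F" for q
  proof -
    have m: "(\<lambda>\<omega>. \<xi> \<omega> u) \<in> borel_measurable (nat_filt (Pb z) ?X q)" if "0 \<le> u" "u \<le> q" for u
      using measurable_compose[OF nat_filt_measurable[OF that, of ?X "Pb z"] fst_borel] by simp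
    let ?F = "{p \<in> F. p < q}"
    have "A q = {\<omega> \<in> space (nat_filt (Pb z) ?X q). ereal L \<le> \<xi> \<omega> q \<and> (\<forall>p\<in>?F. \<xi> \<omega> p < ereal L)}"
      by (auto simp: A_def space_nat_filt)
    also have "\<dots> \<in> sets (nat_filt (Pb z) ?X q)"
    proof (intro sets.sets_Collect_conj sets.sets_Collect_finite_All)
      show "{\<omega> \<in> space (nat_filt (Pb z) ?X q). ereal L \<le> \<xi> \<omega> q} \<in> sets (nat_filt (Pb z) ?X q)"
        using m[of q] q0[OF q] by simp
      fix p assume "p \<in> ?F"
      then show "{\<omega> \<in> space (nat_filt (Pb z) ?X q). \<xi> \<omega> p < ereal L} \<in> sets (nat_filt (Pb z) ?X q)"
        using m[of p] q0[of p] by simp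
    qed (use F in auto)
    finally show ?thesis .
  qed
  have AM [measurable]: "A q \<in> sets (Pb z)" if "q \<in> F" for q
  proof -
    have [measurable]: "(\<lambda>\<omega>. \<xi> \<omega> p) \<in> borel_measurable (Pb z)" if "p \<in> F" for p
      using MAP_component_measurable(1)[OF z] q0[OF that] by simp
    show ?thesis unfolding A_def using F that by measurable
  qed
  have disj: "disjoint_family_on A F"
    unfolding disjoint_family_on_def
  proof (intro ballI impI)
    fix m n assume mn: "m \<in> F" "n \<in> F" "m \<noteq> n"
    then consider "m < n" | "n < m" by linarith
    then show "A m \<inter> A n = {}"
      by cases (use mn in \<open>auto simp: A_def not_le[symmetric]\<close>)
  qed
  define D where "D r = (\<Sum>q\<in>F. \<integral>\<^sup>+\<omega>. indicator (A q) \<omega> * Y \<omega> (q + r) \<partial>Pb z)" for r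
  have Dm: "D \<in> borel_measurable borel"
    unfolding D_def
  proof (rule borel_measurable_sum)
    fix q assume "q \<in> F"
    note [measurable] = AM[OF this]
    show "(\<lambda>r. \<integral>\<^sup>+\<omega>. indicator (A q) \<omega> * Y \<omega> (q + r) \<partial>Pb z) \<in> borel_measurable borel"
      by measurable
  qed
  have Dle: "D r \<le> ennreal e" if "0 \<le> r" "0 \<le> e" "\<forall>p\<in>MAP_states. ereal L \<le> fst p \<longrightarrow> SG r p \<le> e" for r e
  proof -
    have "D r \<le> (\<Sum>q\<in>F. ennreal e * emeasure (Pb z) (A q))"
      unfolding D_def
    proof (rule sum_mono)
      fix q assume q: "q \<in> F"
      have "SG r (\<xi> \<omega> q, \<Theta> \<omega> q) \<le> e" if "\<omega> \<in> A q" for \<omega>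
      proof -
        have "ereal L \<le> \<xi> \<omega> q" "\<omega> \<in> space (Pb z)" using that by (auto simp: A_def)
        then have "?X \<omega> q \<in> MAP_states"
          using MAP_state[OF z _ q0(1)[OF q], of \<omega>] by (auto simp: MAP_states_iff)
        then show ?thesis using \<open>ereal L \<le> \<xi> \<omega> q\<close> \<open>\<forall>p\<in>MAP_states. _ p\<close> by auto
      qed
      from peak_markov[OF z q0(1)[OF q] \<open>0 \<le> r\<close> Anat[OF q] AM[OF q] \<open>0 \<le> e\<close> this]
      show "(\<integral>\<^sup>+\<omega>. indicator (A q) \<omega> * Y \<omega> (q + r) \<partial>Pb z) \<le> ennreal e * emeasure (Pb z) (A q)"
        using q0(1)[OF q] \<open>0 \<le> r\<close> by (simp add: Y_def)
    qed
    also have "\<dots> = ennreal e * (\<Sum>q\<in>F. emeasure (Pb z) (A q))" by (simp add: sum_distrib_left)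
    also have "(\<Sum>q\<in>F. emeasure (Pb z) (A q)) = emeasure (Pb z) (\<Union>(A ` F))"
      by (rule sum_emeasure) (use AM disj F in auto)
    \<comment> \<open>Disjointness bounds the total probability by 1, so the estimate does not
      depend on the size of \<open>F\<close>.\<close>
    also have "ennreal e * \<dots> \<le> ennreal e * 1"
      by (intro mult_left_mono P.emeasure_le_1) simp
    finally show ?thesis by simp
  qed
  have pt: "indicator {\<omega>. \<exists>q\<in>F. ereal L \<le> \<xi> \<omega> q} \<omega> * (\<integral>\<^sup>+v\<in>{s..s+1}. Y \<omega> v \<partial>lborel)
     \<le> (\<integral>\<^sup>+r. (\<Sum>q\<in>F. indicator (A q) \<omega> * Y \<omega> (q + r)) * indicator {0..s+1} r \<partial>lborel)"
    if \<omega>: "\<omega> \<in> space (Pb z)" for \<omega>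
  proof (cases "\<exists>q\<in>F. ereal L \<le> \<xi> \<omega> q")
    case True
    let ?G = "{q \<in> F. ereal L \<le> \<xi> \<omega> q}"
    have G: "finite ?G" "?G \<noteq> {}" using F True by auto
    define q where "q = Min ?G"
    have q: "q \<in> F" "ereal L \<le> \<xi> \<omega> q" using Min_in[OF G] by (auto simp: q_def)
    have "\<xi> \<omega> p < ereal L" if "p \<in> F" "p < q" for p
      using Min_le[OF G(1), of p] that by (force simp: q_def not_less[symmetric])
    then have qA: "\<omega> \<in> A q" using q \<omega> by (simp add: A_def)
    note [measurable] = Y1'[OF \<omega>]
    \<comment> \<open>Time is shifted to start at \<open>q\<close>. As
      \<open>0 \<le> q \<le> s\<close>, the window from \<open>s\<close> to \<open>s + 1\<close>
      becomes a part of \<open>{0..s+1}\<close>, a range that no longer depends on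
      \<open>q\<close>.\<close>
    have "(\<integral>\<^sup>+v\<in>{s..s+1}. Y \<omega> v \<partial>lborel) = (\<integral>\<^sup>+r. Y \<omega> (q + r) * indicator {s..s+1} (q + r) \<partial>lborel)"
      by (subst nn_integral_real_affine[where c=1 and t=q]) simp_all
    also have "\<dots> \<le> (\<integral>\<^sup>+r. (\<Sum>q\<in>F. indicator (A q) \<omega> * Y \<omega> (q + r)) * indicator {0..s+1} r \<partial>lborel)"
    proof (rule nn_integral_mono)
      fix r :: real
      have "Y \<omega> (q + r) = indicator (A q) \<omega> * Y \<omega> (q + r)" using qA by simp
      also have "\<dots> \<le> (\<Sum>q\<in>F. indicator (A q) \<omega> * Y \<omega> (q + r))"
        by (rule member_le_sum) (use q F in auto)
      finally show "Y \<omega> (q + r) * indicator {s..s+1} (q + r)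
          \<le> (\<Sum>q\<in>F. indicator (A q) \<omega> * Y \<omega> (q + r)) * indicator {0..s+1} r"
        using q0[OF q(1)] by (auto simp: indicator_def)
    qed
    finally show ?thesis using True by simp
  qed simp
  have "(\<integral>\<^sup>+\<omega>. indicator {\<omega>. \<exists>q\<in>F. ereal L \<le> \<xi> \<omega> q} \<omega> * (\<integral>\<^sup>+v\<in>{s..s+1}. Y \<omega> v \<partial>lborel) \<partial>Pb z)
     \<le> (\<integral>\<^sup>+\<omega>. \<integral>\<^sup>+r. (\<Sum>q\<in>F. indicator (A q) \<omega> * Y \<omega> (q + r)) * indicator {0..s+1} r \<partial>lborel \<partial>Pb z)"
    by (rule nn_integral_mono) (rule pt)
  also have "\<dots> = (\<integral>\<^sup>+r. \<integral>\<^sup>+\<omega>. (\<Sum>q\<in>F. indicator (A q) \<omega> * Y \<omega> (q + r)) * indicator {0..s+1} r \<partial>Pb z \<partial>lborel)"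
    by (rule Fubini'[symmetric]) (use AM in measurable)
  also have "\<dots> = (\<integral>\<^sup>+r\<in>{0..s+1}. D r \<partial>lborel)"
  proof (rule nn_integral_cong)
    fix r :: real
    have m: "(\<lambda>\<omega>. indicator (A q) \<omega> * Y \<omega> (q + r)) \<in> borel_measurable (Pb z)" if "q \<in> F" for q
      using AM[OF that] by measurable
    have "(\<integral>\<^sup>+\<omega>. (\<Sum>q\<in>F. indicator (A q) \<omega> * Y \<omega> (q + r)) \<partial>Pb z) = D r"
      unfolding D_def by (rule nn_integral_sum) (rule m)
    then show "(\<integral>\<^sup>+\<omega>. (\<Sum>q\<in>F. indicator (A q) \<omega> * Y \<omega> (q + r)) * indicator {0..s+1} r \<partial>Pb z) = D r * indicator {0..s+1} r"
      by (cases "r \<in> {0..s+1}") simp_all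
  qed
  finally show ?thesis using Dm Dle unfolding Y_def by blast
qed

text \<open>Otherwise each level \<open>L\<close> has a bad finite set \<open>F L\<close>. The bound
  on \<open>D\<close> sees only the level and not the set, so \<open>D L\<close> tends to 0
  pointwise by \<open>SG_decay\<close>, and dominated convergence makes the integrals tend to
  0.\<close>

lemma high_level_uniform:
  assumes z: "z \<in> MAP_states" and s: "0 \<le> s" and \<epsilon>: "0 < \<epsilon>"
  shows "\<exists>L::nat. \<forall>F. finite F \<longrightarrow> F \<subseteq> {0..s} \<longrightarrow>
    (\<integral>\<^sup>+\<omega>. indicator {\<omega>. \<exists>q\<in>F. ereal (real L) \<le> \<xi> \<omega> q} \<omega> *
        (\<integral>\<^sup>+v\<in>{s..s+1}. ennreal (peak (\<xi> \<omega> (max 0 v), \<Theta> \<omega> (max 0 v))) \<partial>lborel) \<partial>Pb z) \<le> \<epsilon>"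
proof (rule ccontr)
  let ?I = "\<lambda>L F. (\<integral>\<^sup>+\<omega>. indicator {\<omega>. \<exists>q\<in>F. ereal L \<le> \<xi> \<omega> q} \<omega> *
        (\<integral>\<^sup>+v\<in>{s..s+1}. ennreal (peak (\<xi> \<omega> (max 0 v), \<Theta> \<omega> (max 0 v))) \<partial>lborel) \<partial>Pb z)"
  assume "\<not> ?thesis"
  then have ex: "\<forall>L::nat. \<exists>F. finite F \<and> F \<subseteq> {0..s} \<and> \<epsilon> < ?I (real L) F" by (simp add: not_le)
  obtain F where F': "\<forall>L::nat. finite (F L) \<and> F L \<subseteq> {0..s} \<and> \<epsilon> < ?I (real L) (F L)"
    using choice[OF ex] by (rule exE)
  note F = F'[THEN spec, THEN conjunct1] F'[THEN spec, THEN conjunct2, THEN conjunct1]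
    F'[THEN spec, THEN conjunct2, THEN conjunct2]
  have exD: "\<forall>L::nat. \<exists>D. D \<in> borel_measurable borel \<and>
      (\<forall>r\<ge>0. \<forall>e\<ge>0. (\<forall>p\<in>MAP_states. ereal (real L) \<le> fst p \<longrightarrow> SG r p \<le> e) \<longrightarrow> D r \<le> ennreal e) \<and>
      ?I (real L) (F L) \<le> (\<integral>\<^sup>+r\<in>{0..s+1}. D r \<partial>lborel)"
    by (intro allI high_level_bound[OF z s F(1,2)])
  obtain D where D': "\<forall>L. D L \<in> borel_measurable borel \<and>
      (\<forall>r\<ge>0. \<forall>e\<ge>0. (\<forall>p\<in>MAP_states. ereal (real L) \<le> fst p \<longrightarrow> SG r p \<le> e) \<longrightarrow> D L r \<le> ennreal e) \<and>
      ?I (real L) (F L) \<le> (\<integral>\<^sup>+r\<in>{0..s+1}. D L r \<partial>lborel)"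
    using choice[OF exD] by (rule exE)
  note Dm [measurable] = D'[THEN spec, THEN conjunct1]
    and DI = D'[THEN spec, THEN conjunct2, THEN conjunct2]
  have Dle: "\<And>r e. 0 \<le> r \<Longrightarrow> 0 \<le> e \<Longrightarrow> (\<forall>p\<in>MAP_states. ereal (real L) \<le> fst p \<longrightarrow> SG r p \<le> e) \<Longrightarrow> D L r \<le> ennreal e" for L :: nat
    using D'[THEN spec, THEN conjunct2, THEN conjunct1] by simp
  have lim: "(\<lambda>L. D L r) \<longlonglongrightarrow> 0" if r: "0 \<le> r" for r
  proof (rule order_tendstoI)
    fix a :: ennreal assume "0 < a"
    then obtain x where x: "0 < x" "x < a" using dense by blast
    then obtain e where e: "x = ennreal e" "0 < e" by (cases x) auto
    obtain L0 where L0: "\<forall>p\<in>MAP_states. ereal L0 \<le> fst p \<longrightarrow> SG r p \<le> e" using SG_decay[OF r e(2)] by blast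
    have "D L r < a" if "nat \<lceil>L0\<rceil> \<le> L" for L
    proof -
      have "L0 \<le> real L" using that by linarith
      then have "\<forall>p\<in>MAP_states. ereal (real L) \<le> fst p \<longrightarrow> SG r p \<le> e"
        using L0 by (meson ereal_less_eq(3) order_trans)
      then have "D L r \<le> ennreal e" using Dle[OF r] e by simp
      then show ?thesis using x e by auto
    qed
    then show "eventually (\<lambda>L. D L r < a) sequentially" unfolding eventually_sequentially by blast
  qed simp
  have "(\<lambda>L. \<integral>\<^sup>+r. D L r * indicator {0..s+1} r \<partial>lborel) \<longlonglongrightarrow> (\<integral>\<^sup>+r. 0 \<partial>(lborel :: real measure))"
  proof (rule nn_integral_dominated_convergence[where w="indicator {0..s+1}"])
    show "AE r in lborel. D L r * indicator {0..s+1} r \<le> indicator {0..s+1} r" for L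
    proof (rule AE_I2)
      fix r :: real
      show "D L r * indicator {0..s+1} r \<le> indicator {0..s+1} r"
        \<comment> \<open>Since the semigroup never exceeds 1, the choice \<open>e = 1\<close>
          yields the dominating function.\<close>
        using Dle[of r 1 L] SG_le_1[of _ r] by (auto simp: indicator_def)
    qed
    show "AE r in lborel. (\<lambda>L. D L r * indicator {0..s+1} r) \<longlonglongrightarrow> 0"
      using lim by (intro AE_I2) (auto simp: indicator_def)
  qed (use s in \<open>auto simp: emeasure_lborel_Icc_eq less_top[symmetric]\<close>)
  then have "(\<lambda>L. \<integral>\<^sup>+r. D L r * indicator {0..s+1} r \<partial>lborel) \<longlonglongrightarrow> 0" by simp
  then have "eventually (\<lambda>L. (\<integral>\<^sup>+r. D L r * indicator {0..s+1} r \<partial>lborel) < \<epsilon>) sequentially"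
    using \<epsilon> by (rule order_tendstoD(2))
  then obtain L where "(\<integral>\<^sup>+r. D L r * indicator {0..s+1} r \<partial>lborel) < \<epsilon>"
    unfolding eventually_sequentially by blast
  then show False using DI[of L] F(3)[of L] by (meson le_less_trans less_asym less_le_trans)
qed

text \<open>On the event that the rational times up to \<open>s\<close> carry unbounded levels, the
  expectation of \<open>J\<close> is zero. But \<open>J\<close> is positive whenever the process is
  alive at \<open>s\<close>, because it stays alive for a while.\<close>

lemma MAP_bounded_rational:
  assumes z: "z \<in> MAP_states" and s: "0 \<le> s"
  shows "AE \<omega> in Pb z. \<Theta> \<omega> s \<noteq> 0 \<longrightarrow> (\<exists>L::nat. \<forall>q\<in>\<rat> \<inter> {0..s}. \<xi> \<omega> q < ereal (real L))"
proof -
  define J where "J \<omega> = (\<integral>\<^sup>+v\<in>{s..s+1}. ennreal (peak (\<xi> \<omega> (max 0 v), \<Theta> \<omega> (max 0 v))) \<partial>lborel)" for \<omega>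
  have [measurable]: "J \<in> borel_measurable (Pb z)"
    using peak_process_measurable[OF z] unfolding J_def by measurable
  let ?Q = "\<rat> \<inter> {0..s}"
  have cQ: "countable ?Q" "?Q \<noteq> {}" using s by (auto simp: countable_rat intro: countable_Int1)
  \<comment> \<open>Initial segments of an enumeration increase to the rational times, so monotone
    convergence extends the bound from finite sets to all of them.\<close>
  define F where "F N = from_nat_into ?Q ` {..<N}" for N :: nat
  have F: "finite (F N)" "F N \<subseteq> {0..s}" for N
    using from_nat_into[OF cQ(2)] by (auto simp: F_def)
  have FQ: "(\<Union>N. F N) = ?Q"
    using range_from_nat_into[OF cQ(2,1)] by (fastforce simp: F_def)
  have Nm [measurable]: "{\<omega> \<in> space (Pb z). \<forall>L::nat. \<exists>q\<in>?Q. ereal (real L) \<le> \<xi> \<omega> q} \<in> sets (Pb z)"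
  proof -
    have m: "{\<omega> \<in> space (Pb z). ereal (real L) \<le> \<xi> \<omega> q} \<in> sets (Pb z)" if "q \<in> ?Q" for q and L :: nat
      using MAP_component_measurable(1)[OF z, of q] that by simp
    show ?thesis
      by (intro sets.sets_Collect_countable_All sets.sets_Collect_countable_Ex' cQ(1) m)
  qed
  let ?N' = "{\<omega> \<in> space (Pb z). \<forall>L::nat. \<exists>q\<in>?Q. ereal (real L) \<le> \<xi> \<omega> q}"
  \<comment> \<open>The level \<open>L\<close> may depend on \<open>\<epsilon>\<close>: the event of
    unbounded levels lies in the union of the \<open>B N\<close> for every \<open>L\<close>.\<close>
  have "(\<integral>\<^sup>+\<omega>. indicator ?N' \<omega> * J \<omega> \<partial>Pb z) \<le> \<epsilon>" if \<epsilon>: "0 < \<epsilon>" for \<epsilon>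
  proof -
    obtain L :: nat where L: "\<forall>F. finite F \<longrightarrow> F \<subseteq> {0..s} \<longrightarrow>
      (\<integral>\<^sup>+\<omega>. indicator {\<omega>. \<exists>q\<in>F. ereal (real L) \<le> \<xi> \<omega> q} \<omega> * J \<omega> \<partial>Pb z) \<le> \<epsilon>"
      using high_level_uniform[OF z s \<epsilon>] unfolding J_def by (rule exE)
    define B where "B N = {\<omega> \<in> space (Pb z). \<exists>q\<in>F N. ereal (real L) \<le> \<xi> \<omega> q}" for N
    have Bm [measurable]: "B N \<in> sets (Pb z)" for N
      unfolding B_def
    proof (intro sets.sets_Collect_finite_Ex F(1))
      fix q assume "q \<in> F N"
      then show "{\<omega> \<in> space (Pb z). ereal (real L) \<le> \<xi> \<omega> q} \<in> sets (Pb z)"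
        using MAP_component_measurable(1)[OF z, of q] F(2)[of N] by auto
    qed
    have inc: "B m \<subseteq> B n" if "m \<le> n" for m n
      using that by (fastforce simp: B_def F_def)
    have "(\<integral>\<^sup>+\<omega>. indicator ?N' \<omega> * J \<omega> \<partial>Pb z) \<le> (\<integral>\<^sup>+\<omega>. (SUP N. indicator (B N) \<omega> * J \<omega>) \<partial>Pb z)"
    proof (rule nn_integral_mono)
      fix \<omega>
      show "indicator ?N' \<omega> * J \<omega> \<le> (SUP N. indicator (B N) \<omega> * J \<omega>)"
      proof (cases "\<omega> \<in> ?N'")
        case True
        then obtain q where "q \<in> ?Q" "ereal (real L) \<le> \<xi> \<omega> q" by blast
        then obtain N where "q \<in> F N" using FQ by blast
        then have "\<omega> \<in> B N" using True \<open>ereal (real L) \<le> \<xi> \<omega> q\<close> by (auto simp: B_def)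
        then show ?thesis using True by (intro SUP_upper2[of N]) auto
      qed simp
    qed
    also have "\<dots> = (SUP N. \<integral>\<^sup>+\<omega>. indicator (B N) \<omega> * J \<omega> \<partial>Pb z)"
    proof (rule nn_integral_monotone_convergence_SUP)
      show "incseq (\<lambda>N \<omega>. indicator (B N) \<omega> * J \<omega>)"
        using inc by (intro monoI le_funI mult_right_mono) (auto simp: indicator_def)
    qed measurable
    also have "\<dots> \<le> \<epsilon>"
    proof (rule SUP_least)
      fix N
      have "(\<integral>\<^sup>+\<omega>. indicator (B N) \<omega> * J \<omega> \<partial>Pb z)
          = (\<integral>\<^sup>+\<omega>. indicator {\<omega>. \<exists>q\<in>F N. ereal (real L) \<le> \<xi> \<omega> q} \<omega> * J \<omega> \<partial>Pb z)"
        by (intro nn_integral_cong) (auto simp: B_def indicator_def)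
      also have "\<dots> \<le> \<epsilon>" by (rule L[rule_format, OF F])
      finally show "(\<integral>\<^sup>+\<omega>. indicator (B N) \<omega> * J \<omega> \<partial>Pb z) \<le> \<epsilon>" .
    qed
    finally show ?thesis .
  qed
  then have "(\<integral>\<^sup>+\<omega>. indicator ?N' \<omega> * J \<omega> \<partial>Pb z) \<le> 0" by (rule dense_ge)
  then have "(\<integral>\<^sup>+\<omega>. indicator ?N' \<omega> * J \<omega> \<partial>Pb z) = 0" by simp
  then have "AE \<omega> in Pb z. indicator ?N' \<omega> * J \<omega> = 0" by (subst (asm) nn_integral_0_iff_AE) auto
  then show ?thesis
  proof (rule AE_mp[OF _ AE_I2], intro impI)
    fix \<omega> assume \<omega>: "\<omega> \<in> space (Pb z)" and 0: "indicator ?N' \<omega> * J \<omega> = 0" and al: "\<Theta> \<omega> s \<noteq> 0"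
    \<comment> \<open>The real path of \<open>peak\<close> is itself an absorbed path, and its clock
      with exponent 1 is its integral; \<open>clock_strict\<close> then shows that \<open>J\<close>
      is positive.\<close>
    let ?Y = "\<lambda>t. peak (\<xi> \<omega> t, \<Theta> \<omega> t)"
    have Y: "?Y t = 0 \<longleftrightarrow> \<Theta> \<omega> t = 0" if "0 \<le> t" for t
      using MAP_state[OF z \<omega> that] by (auto simp: peak_def)
    have ap: "absorbed_path ?Y"
      unfolding absorbed_path_def
    proof (intro conjI allI impI)
      show "right_cont ?Y" by (rule MAP_right_cont_map[OF z \<omega> isCont_peak])
      fix t u :: real assume t: "0 \<le> t" "t \<le> u" "?Y t = 0"
      then have "\<Theta> \<omega> u = 0" using MAP_absorbed(2)[OF z \<omega> t(1,2)] Y[OF t(1)] by blast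
      then show "?Y u = 0" using Y[of u] t by simp
    qed
    have rcY: "right_cont ?Y" using ap by (simp only: absorbed_path_def)
    have c: "emeasure (clock_measure 1 ?Y) A = (\<integral>\<^sup>+u\<in>A. ennreal (?Y u) \<partial>lborel)"
      if "A \<in> sets borel" "A \<subseteq> {0..}" for A
      by (simp add: emeasure_clock_measure[OF rcY that] abs_of_nonneg[OF peak_bounds(1)] peak_bounds(1))
    have "clock 1 ?Y s \<le> (\<integral>\<^sup>+u\<in>{0..s}. 1 \<partial>lborel)"
      unfolding clock_def
      by (subst c, simp, simp, intro nn_integral_mono) (simp add: indicator_def peak_bounds)
    also have "\<dots> < \<top>" using s by simp
    finally have sl: "s \<in> live 1 ?Y" using al Y[OF s] s by (simp add: live_def)
    have "clock 1 ?Y s < clock 1 ?Y (s + 1)" by (rule clock_strict[OF ap sl]) simp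
    then have "emeasure (clock_measure 1 ?Y) {s<..s+1} \<noteq> 0"
      using clock_add[OF s, of "s + 1" 1 ?Y] by auto
    moreover have "emeasure (clock_measure 1 ?Y) {s<..s+1} \<le> J \<omega>"
      unfolding J_def using s
      by (subst c) (auto intro!: nn_integral_mono simp: indicator_def max_def)
    ultimately have "J \<omega> \<noteq> 0" by auto
    then have "\<omega> \<notin> ?N'" using 0 by (auto simp: indicator_def split: if_splits)
    then show "\<exists>L::nat. \<forall>q\<in>?Q. \<xi> \<omega> q < ereal (real L)" using \<omega> by (auto simp: not_le)
  qed
qed

section \<open>The encoding path and the Lamperti-Kiu transform\<close>

abbreviation (input) MAP_path :: "'v \<Rightarrow> real \<Rightarrow> real^'n" where
  "MAP_path \<omega> \<equiv> (\<lambda>t. eexp (\<xi> \<omega> t) *\<^sub>R \<Theta> \<omega> t)"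

lemma MAP_path_measurable:
  assumes "z \<in> MAP_states" "0 \<le> t"
  shows "(\<lambda>\<omega>. MAP_path \<omega> t) \<in> borel_measurable (Pb z)"
  using MAP_component_measurable[OF assms] by measurable

lemma MAP_path_eq_0_iff:
  assumes "z \<in> MAP_states" "\<omega> \<in> space (Pb z)" "0 \<le> t"
  shows "MAP_path \<omega> t = 0 \<longleftrightarrow> \<Theta> \<omega> t = 0"
  using MAP_state[OF assms] by auto

lemma absorbed_MAP_path:
  assumes z: "z \<in> MAP_states" "\<omega> \<in> space (Pb z)"
  shows "absorbed_path (MAP_path \<omega>)"
  unfolding absorbed_path_def
proof (intro conjI allI impI)
  have "isCont (\<lambda>p. eexp (fst p) *\<^sub>R snd p) p" if "p \<in> (MAP_states :: (ereal \<times> (real^'n)) set)" for p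
  proof -
    from that obtain x where x: "fst p = ereal x" by (auto simp: MAP_states_def)
    have "isCont eexp (fst p)"
      unfolding x by (rule isCont_ereal_comp) (auto intro!: continuous_intros)
    then have "isCont (\<lambda>p. eexp (fst p)) p" by (intro isCont_o2[where f=fst and g=eexp]) (auto intro: continuous_intros)
    then show ?thesis by (intro continuous_intros)
  qed
  from MAP_right_cont_map[OF z this] show "right_cont (MAP_path \<omega>)" by simp
  fix t s :: real assume t: "0 \<le> t" "t \<le> s" "MAP_path \<omega> t = 0"
  then have "\<Theta> \<omega> t = 0" using MAP_path_eq_0_iff[OF z t(1)] by blast
  from MAP_absorbed(2)[OF z t(1,2) this] show "MAP_path \<omega> s = 0" by simp
qed

text \<open>The exceptional sets are united over countably many rational times only.
  Right-continuity of \<xi> carries a bound from rational times to all times, and a bounded level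
  makes the clock finite.\<close>

lemma live_MAP_path:
  assumes z: "z \<in> MAP_states" and \<alpha>: "0 < \<alpha>"
  shows "AE \<omega> in Pb z. \<forall>s\<ge>0. MAP_path \<omega> s \<noteq> 0 \<longrightarrow> s \<in> live \<alpha> (MAP_path \<omega>)"
proof -
  have "AE \<omega> in Pb z. \<forall>s\<in>\<rat> \<inter> {0..}. \<Theta> \<omega> s \<noteq> 0 \<longrightarrow> (\<exists>L::nat. \<forall>q\<in>\<rat> \<inter> {0..s}. \<xi> \<omega> q < ereal (real L))"
    by (subst AE_ball_countable) (auto intro!: MAP_bounded_rational[OF z] countable_Int1 countable_rat)
  then show ?thesis
  proof (rule AE_mp[OF _ AE_I2], intro impI allI)
    fix \<omega> and s :: real
    assume \<omega>: "\<omega> \<in> space (Pb z)" and s: "0 \<le> s" and al: "MAP_path \<omega> s \<noteq> 0"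
      and bd: "\<forall>s\<in>\<rat> \<inter> {0..}. \<Theta> \<omega> s \<noteq> 0 \<longrightarrow> (\<exists>L::nat. \<forall>q\<in>\<rat> \<inter> {0..s}. \<xi> \<omega> q < ereal (real L))"
    let ?y = "MAP_path \<omega>"
    note ap = absorbed_MAP_path[OF z \<omega>]
    have rc: "right_cont ?y" using ap by (simp only: absorbed_path_def)
    obtain d where d: "0 < d" "\<And>u. s < u \<Longrightarrow> u < s + d \<Longrightarrow> ?y u \<noteq> 0"
      using eventually_right_pos[OF ap s al, of 1] by metis
    \<comment> \<open>The rational time lies after \<open>s\<close> while the process is still
      alive, so that rationals to the right of every \<open>u \<le> s\<close>, including
      \<open>u = s\<close>, are covered by the bound.\<close>
    obtain s' where s': "s' \<in> \<rat>" "s < s'" "s' < s + d" using Rats_dense_in_real[of s "s + d"] d by auto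
    have "\<Theta> \<omega> s' \<noteq> 0" using d(2)[OF s'(2,3)] by auto
    moreover have "s' \<in> \<rat> \<inter> {0..}" using s' s by simp
    ultimately obtain L :: nat where L': "\<forall>q\<in>\<rat> \<inter> {0..s'}. \<xi> \<omega> q < ereal (real L)"
      using bd by blast
    have L: "\<xi> \<omega> q < ereal (real L)" if "q \<in> \<rat>" "0 \<le> q" "q \<le> s'" for q
      using bspec[OF L', of q] that by simp
    have bnd: "\<xi> \<omega> u \<le> ereal (real L)" if u: "0 \<le> u" "u \<le> s" for u
    proof (rule ccontr)
      assume "\<not> ?thesis"
      then have gt: "ereal (real L) < \<xi> \<omega> u" by simp
      have "right_cont (\<lambda>t. fst (\<xi> \<omega> t, \<Theta> \<omega> t))"
        by (rule MAP_right_cont_map[OF z \<omega>]) (intro continuous_intros)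
      then have "(\<xi> \<omega> \<longlongrightarrow> \<xi> \<omega> u) (at_right u)" using u by (simp add: right_cont_def)
      from order_tendstoD(1)[OF this gt] obtain b where b: "b > u" "\<And>v. u < v \<Longrightarrow> v < b \<Longrightarrow> ereal (real L) < \<xi> \<omega> v"
        unfolding eventually_at_right_field by blast
      obtain q where q: "q \<in> \<rat>" "u < q" "q < min b s'"
        using Rats_dense_in_real[of u "min b s'"] b u s' by auto
      then show False using L[of q] b(2)[of q] u by auto
    qed
    have "clock \<alpha> ?y s \<le> (\<integral>\<^sup>+u\<in>{0..s}. ennreal (exp (real L) powr \<alpha>) \<partial>lborel)"
      unfolding clock_def
    proof (subst emeasure_clock_measure[OF rc], simp, simp, intro nn_integral_mono)
      fix u :: real
      show "ennreal (norm (?y u) powr \<alpha>) * indicator {0..s} u \<le> ennreal (exp (real L) powr \<alpha>) * indicator {0..s} u"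
      proof (cases "u \<in> {0..s}")
        case True
        then have "norm (?y u) \<le> exp (real L)"
          using MAP_state[OF z \<omega>, of u] bnd[of u] by auto
        then show ?thesis using \<alpha> by (auto intro!: mult_right_mono ennreal_leI powr_mono2)
      qed simp
    qed
    also have "\<dots> < \<top>" using s by (simp add: nn_integral_cmult_indicator ennreal_mult_less_top)
    finally show "s \<in> live \<alpha> ?y" using s al by (simp add: live_def)
  qed
qed

lemma MAP_path_time_change_inverse:
  assumes z: "z \<in> MAP_states" and \<alpha>: "0 < \<alpha>"
  shows "AE \<omega> in Pb z. \<forall>t\<ge>0. time_change (- \<alpha>) (time_change \<alpha> (MAP_path \<omega>)) t = MAP_path \<omega> t"
  using live_MAP_path[OF assms]
proof (rule AE_mp[OF _ AE_I2], intro impI allI)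
  fix \<omega> and t :: real
  assume \<omega>: "\<omega> \<in> space (Pb z)" and t: "0 \<le> t"
    and l: "\<forall>s\<ge>0. MAP_path \<omega> s \<noteq> 0 \<longrightarrow> s \<in> live \<alpha> (MAP_path \<omega>)"
  show "time_change (- \<alpha>) (time_change \<alpha> (MAP_path \<omega>)) t = MAP_path \<omega> t"
    using l t unfolding time_change_inverse[OF absorbed_MAP_path[OF z \<omega>] t] by auto
qed

text \<open>The integrands agree, being zero on both sides after death. The total of the transform
  integrates only up to the lifetime, which changes nothing: later levels are
  \<open>-\<infinity>\<close>, and the lifetime itself is one point.\<close>

lemma lk_path_eq_time_change:
  assumes z: "z \<in> MAP_states" "\<omega> \<in> space (Pb z)" and \<alpha>: "0 < \<alpha>"
  shows "lk_path \<alpha> (\<xi> \<omega>) (\<Theta> \<omega>) t = time_change \<alpha> (MAP_path \<omega>) t"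
proof -
  let ?y = "MAP_path \<omega>"
  have rc: "right_cont ?y" using absorbed_MAP_path[OF z] by (simp only: absorbed_path_def)
  have h: "eexp (ereal \<alpha> * \<xi> \<omega> u) = norm (?y u) powr \<alpha>" if "0 \<le> u" for u
    using MAP_state[OF z that] \<alpha> by (auto simp: powr_def)
  have c: "lk_clock \<alpha> (\<xi> \<omega>) s = clock \<alpha> ?y s" for s
    unfolding lk_clock_def clock_def
    by (subst emeasure_clock_measure[OF rc]) (auto intro!: nn_integral_cong simp: h indicator_def)
  \<comment> \<open>The null point is written with \<open>real_of_ereal\<close>; for an infinite
    lifetime it is 0, and excluding it is harmless.\<close>
  have dead: "eexp (ereal \<alpha> * \<xi> \<omega> u) = 0"
    if u: "0 \<le> u" "\<not> ereal u < lifetime (\<Theta> \<omega>)" "u \<noteq> real_of_ereal (lifetime (\<Theta> \<omega>))" for u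
  proof -
    have "lifetime (\<Theta> \<omega>) \<noteq> ereal u" using u(3) by auto
    then have "lifetime (\<Theta> \<omega>) < ereal u" using u(2) by auto
    then obtain v where v: "0 < v" "\<Theta> \<omega> v = 0" "v < u"
      unfolding lifetime_def Inf_less_iff by auto
    then have "\<xi> \<omega> u = -\<infinity>" using MAP_absorbed(1)[OF z, of v u] by simp
    then show ?thesis using \<alpha> by simp
  qed
  have t: "lk_total \<alpha> (\<xi> \<omega>) (\<Theta> \<omega>) = clock_total \<alpha> ?y"
    unfolding lk_total_def clock_total_def
  proof (subst emeasure_clock_measure[OF rc], simp, simp, rule nn_integral_cong_AE)
    show "AE u in lborel. ennreal (eexp (ereal \<alpha> * \<xi> \<omega> u)) * indicator {u. 0 \<le> u \<and> ereal u < lifetime (\<Theta> \<omega>)} u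
        = ennreal (norm (?y u) powr \<alpha>) * indicator {0..} u"
      using AE_lborel_singleton[of "real_of_ereal (lifetime (\<Theta> \<omega>))"]
    proof eventually_elim
      case (elim u)
      then show ?case using h[of u] dead[of u] by (auto simp: indicator_def)
    qed
  qed
  show ?thesis
    by (simp add: lk_path_def time_change_def t lk_time_def clock_inv_def c)
qed

end

section \<open>Transfer of laws and isotropy\<close>

lemma orthogonal_matrix_inv_isometry:
  fixes U :: "real^'n^'n"
  assumes "orthogonal_matrix U"
  shows "norm (matrix_inv U *v x) = norm x"
proof -
  have "U ** transpose U = mat 1" "transpose U ** U = mat 1"
    using assms by (simp_all add: orthogonal_matrix_def)
  \<comment> \<open>\<open>matrix_inv\<close> is a chosen inverse; the transpose witnesses that the
    choice is not void.\<close>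
  then have inv: "U ** matrix_inv U = mat 1"
    using someI[of "\<lambda>B. U ** B = mat 1 \<and> B ** U = mat 1" "transpose U"] by (simp add: matrix_inv_def)
  have "orthogonal_transformation ((*v) U)"
    using assms by (simp add: orthogonal_transformation_matrix matrix_vector_mul_linear)
  then have "norm (matrix_inv U *v x) = norm (U *v (matrix_inv U *v x))"
    by (simp only: orthogonal_transformation_norm)
  also have "U *v (matrix_inv U *v x) = x" by (simp add: matrix_vector_mul_assoc inv)
  finally show ?thesis .
qed

lemma MAP_law_iff_path_law:
  fixes \<xi> :: "'v \<Rightarrow> real \<Rightarrow> ereal" and \<Theta> :: "'v \<Rightarrow> real \<Rightarrow> real^'n"
  assumes feller: "feller_process MAP_states {(-\<infinity>, 0)} Pb (\<lambda>\<omega> t. (\<xi> \<omega> t, \<Theta> \<omega> t))"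
    and z: "z \<in> MAP_states" "z' \<in> MAP_states"
    and V: "linear V" "\<And>x. norm (V x) = norm x"
  shows "law (Pb z) (\<lambda>\<omega> t. (\<xi> \<omega> t, V (\<Theta> \<omega> t))) = law (Pb z') (\<lambda>\<omega> t. (\<xi> \<omega> t, \<Theta> \<omega> t)) \<longleftrightarrow>
    law (Pb z) (\<lambda>\<omega> t. V (eexp (\<xi> \<omega> t) *\<^sub>R \<Theta> \<omega> t)) = law (Pb z') (\<lambda>\<omega> t. eexp (\<xi> \<omega> t) *\<^sub>R \<Theta> \<omega> t)"
    (is "?L \<longleftrightarrow> ?R")
proof
  have Vm [measurable]: "V \<in> borel_measurable borel"
    using V(1) by (intro borel_measurable_continuous_onI linear_continuous_on linear_conv_bounded_linear[THEN iffD1])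
  note m = MAP_component_measurable[OF feller] and pm = MAP_path_measurable[OF feller]
  have VX: "(\<lambda>\<omega>. (\<xi> \<omega> t, V (\<Theta> \<omega> t))) \<in> borel_measurable (Pb z)" if "0 \<le> t" for t
    using m[OF z(1) that] by measurable
  show ?R if ?L
  proof -
    have "(\<lambda>p. eexp (fst p) *\<^sub>R snd p) \<in> borel_measurable (borel :: (ereal \<times> (real^'n)) measure)"
      by measurable
    from law_map[OF VX MAP_measurable[OF feller z(2)] this that]
    show ?thesis by (simp add: linear_cmul[OF V(1)])
  qed
  show ?L if ?R
  proof -
    \<comment> \<open>Polar decoding. The level of the zero vector is set to
      \<open>-\<infinity>\<close> by hand, while \<open>sgn 0 = 0\<close> already is the code of the
      dead angle. Isometries leave the level alone and act on the angle.\<close>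
    define dec where "dec v = (if v = 0 then -\<infinity> else ereal (ln (norm v)), sgn v)" for v :: "real^'n"
    have decm: "dec \<in> borel_measurable borel"
      unfolding dec_def[abs_def] sgn_div_norm by measurable
    have Vy: "(\<lambda>\<omega>. V (eexp (\<xi> \<omega> t) *\<^sub>R \<Theta> \<omega> t)) \<in> borel_measurable (Pb z)" if "0 \<le> t" for t
      using pm[OF z(1) that] by measurable
    have eq: "law (Pb z) (\<lambda>\<omega> t. dec (V (eexp (\<xi> \<omega> t) *\<^sub>R \<Theta> \<omega> t)))
        = law (Pb z') (\<lambda>\<omega> t. dec (eexp (\<xi> \<omega> t) *\<^sub>R \<Theta> \<omega> t))"
      by (rule law_map[OF Vy pm[OF z(2)] decm that])
    have dec: "dec (W (eexp (\<xi> \<omega> t) *\<^sub>R \<Theta> \<omega> t)) = (\<xi> \<omega> t, W (\<Theta> \<omega> t))"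
      if W: "linear W" "\<And>x. norm (W x) = norm x" and u: "u \<in> MAP_states" and \<omega>: "\<omega> \<in> space (Pb u)" and t: "0 \<le> t"
      for \<omega> t u and W :: "real^'n \<Rightarrow> real^'n"
      using MAP_state[OF feller u \<omega> t]
    proof (elim disjE exE conjE)
      fix x assume x: "\<xi> \<omega> t = ereal x" "norm (\<Theta> \<omega> t) = 1"
      then have "W (\<Theta> \<omega> t) \<noteq> 0" using W(2)[of "\<Theta> \<omega> t"] by auto
      then show ?thesis using x W(2)[of "\<Theta> \<omega> t"]
        by (simp add: dec_def linear_cmul[OF W(1)] sgn_div_norm ln_mult)
    qed (simp add: dec_def linear_0[OF W(1)])
    have "law (Pb z) (\<lambda>\<omega> t. dec (V (eexp (\<xi> \<omega> t) *\<^sub>R \<Theta> \<omega> t))) = law (Pb z) (\<lambda>\<omega> t. (\<xi> \<omega> t, V (\<Theta> \<omega> t)))"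
      by (rule law_cong) (rule dec[OF V z(1)])
    moreover have "law (Pb z') (\<lambda>\<omega> t. dec (eexp (\<xi> \<omega> t) *\<^sub>R \<Theta> \<omega> t)) = law (Pb z') (\<lambda>\<omega> t. (\<xi> \<omega> t, \<Theta> \<omega> t))"
      by (rule law_cong) (rule dec[of "\<lambda>x. x", OF linear_ident refl z(2)])
    ultimately show ?thesis using eq by (simp only:)
  qed
qed

text \<open>The forward time change is applied in one direction and its inverse in the other;
  \<open>V\<close> passes through both because it preserves norms.\<close>

lemma path_law_iff_time_change_law:
  fixes \<xi> :: "'v \<Rightarrow> real \<Rightarrow> ereal" and \<Theta> :: "'v \<Rightarrow> real \<Rightarrow> real^'n"
  assumes feller: "feller_process MAP_states {(-\<infinity>, 0)} Pb (\<lambda>\<omega> t. (\<xi> \<omega> t, \<Theta> \<omega> t))"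
    and z: "z \<in> MAP_states" "z' \<in> MAP_states" and \<alpha>: "0 < \<alpha>"
    and V: "linear V" "\<And>x. norm (V x) = norm x"
  shows "law (Pb z) (\<lambda>\<omega> t. V (eexp (\<xi> \<omega> t) *\<^sub>R \<Theta> \<omega> t)) = law (Pb z') (\<lambda>\<omega> t. eexp (\<xi> \<omega> t) *\<^sub>R \<Theta> \<omega> t) \<longleftrightarrow>
    law (Pb z) (\<lambda>\<omega> t. V (lk_path \<alpha> (\<xi> \<omega>) (\<Theta> \<omega>) t)) = law (Pb z') (\<lambda>\<omega>. lk_path \<alpha> (\<xi> \<omega>) (\<Theta> \<omega>))"
    (is "?L \<longleftrightarrow> ?R")
proof -
  define y where "y \<omega> t = eexp (\<xi> \<omega> t) *\<^sub>R \<Theta> \<omega> t" for \<omega> t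
  define Y where "Y \<omega> = time_change \<alpha> (y \<omega>)" for \<omega>
  have Vm [measurable]: "V \<in> borel_measurable borel"
    using V(1) by (intro borel_measurable_continuous_onI linear_continuous_on linear_conv_bounded_linear[THEN iffD1])
  have ym: "(\<lambda>\<omega>. y \<omega> t) \<in> borel_measurable (Pb u)" if "u \<in> MAP_states" "0 \<le> t" for u t
    using MAP_path_measurable[OF feller that] by (simp add: y_def)
  have yp: "absorbed_path (y \<omega>)" if "u \<in> MAP_states" "\<omega> \<in> space (Pb u)" for u \<omega>
    using absorbed_MAP_path[OF feller that] by (simp add: y_def[abs_def])
  have yr: "right_cont (y \<omega>)" if "u \<in> MAP_states" "\<omega> \<in> space (Pb u)" for u \<omega>
    using yp[OF that] by (simp only: absorbed_path_def)
  have Yr: "right_cont (Y \<omega>)" if "u \<in> MAP_states" "\<omega> \<in> space (Pb u)" for u \<omega>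
    using absorbed_path_time_change[OF yp[OF that]] by (simp only: absorbed_path_def Y_def)
  have Ym: "(\<lambda>\<omega>. Y \<omega> t) \<in> borel_measurable (Pb u)" if "u \<in> MAP_states" "0 \<le> t" for u t
    unfolding Y_def using that by (intro time_change_process_measurable ym yr)
  have Vr: "right_cont (\<lambda>t. V (w t))" if "right_cont w" for w :: "real \<Rightarrow> real^'n"
    using that linear_continuous_at[OF V(1)[unfolded linear_conv_bounded_linear]]
    by (auto simp: right_cont_def intro: isCont_tendsto_compose)
  have inv: "AE \<omega> in Pb u. \<forall>t\<ge>0. time_change (- \<alpha>) (Y \<omega>) t = y \<omega> t" if "u \<in> MAP_states" for u
    using MAP_path_time_change_inverse[OF feller that \<alpha>] by (simp add: Y_def y_def[abs_def])
  have im: "(\<lambda>\<omega>. time_change (- \<alpha>) (Y \<omega>) t) \<in> borel_measurable (Pb u)" if "u \<in> MAP_states" "0 \<le> t" for u t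
    using that by (intro time_change_process_measurable Ym Yr)
  have "?L \<longleftrightarrow> law (Pb z) (\<lambda>\<omega> t. V (y \<omega> t)) = law (Pb z') y" by (simp add: y_def[abs_def])
  also have "\<dots> \<longleftrightarrow> law (Pb z) (\<lambda>\<omega> t. V (Y \<omega> t)) = law (Pb z') Y"
  proof
    assume "law (Pb z) (\<lambda>\<omega> t. V (y \<omega> t)) = law (Pb z') y"
    then have "law (Pb z) (\<lambda>\<omega>. time_change \<alpha> (\<lambda>t. V (y \<omega> t))) = law (Pb z') (\<lambda>\<omega>. time_change \<alpha> (y \<omega>))"
    proof (rule law_time_change[rotated -1])
      show "(\<lambda>\<omega>. V (y \<omega> u)) \<in> borel_measurable (Pb z)" if "0 \<le> u" for u
        using ym[OF z(1) that] by measurable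
      show "right_cont (\<lambda>t. V (y \<omega> t))" if "\<omega> \<in> space (Pb z)" for \<omega>
        by (rule Vr[OF yr[OF z(1) that]])
    qed (fact ym[OF z(2)] yr[OF z(2)])+
    moreover have "(\<lambda>\<omega>. time_change \<alpha> (\<lambda>t. V (y \<omega> t))) = (\<lambda>\<omega> t. V (Y \<omega> t))"
      unfolding Y_def by (intro ext time_change_map[OF V])
    ultimately show "law (Pb z) (\<lambda>\<omega> t. V (Y \<omega> t)) = law (Pb z') Y"
      by (simp add: Y_def[abs_def])
  next
    assume "law (Pb z) (\<lambda>\<omega> t. V (Y \<omega> t)) = law (Pb z') Y"
    then have "law (Pb z) (\<lambda>\<omega>. time_change (- \<alpha>) (\<lambda>t. V (Y \<omega> t))) = law (Pb z') (\<lambda>\<omega>. time_change (- \<alpha>) (Y \<omega>))"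
    proof (rule law_time_change[rotated -1])
      show "(\<lambda>\<omega>. V (Y \<omega> u)) \<in> borel_measurable (Pb z)" if "0 \<le> u" for u
        using Ym[OF z(1) that] by measurable
      show "right_cont (\<lambda>t. V (Y \<omega> t))" if "\<omega> \<in> space (Pb z)" for \<omega>
        by (rule Vr[OF Yr[OF z(1) that]])
    qed (fact Ym[OF z(2)] Yr[OF z(2)])+
    moreover have "(\<lambda>\<omega>. time_change (- \<alpha>) (\<lambda>t. V (Y \<omega> t))) = (\<lambda>\<omega> t. V (time_change (- \<alpha>) (Y \<omega>) t))"
      by (intro ext time_change_map[OF V])
    \<comment> \<open>The inverse returns \<open>y\<close> only almost surely, since a null set of
      paths may have an exploding clock.\<close>
    moreover have "law (Pb z) (\<lambda>\<omega> t. V (time_change (- \<alpha>) (Y \<omega>) t)) = law (Pb z) (\<lambda>\<omega> t. V (y \<omega> t))"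
    proof (rule law_cong_AE)
      show "AE \<omega> in Pb z. \<forall>t\<ge>0. V (time_change (- \<alpha>) (Y \<omega>) t) = V (y \<omega> t)"
        using inv[OF z(1)] by eventually_elim simp
    qed (rule measurable_compose[OF im[OF z(1)] Vm] measurable_compose[OF ym[OF z(1)] Vm], assumption)+
    moreover have "law (Pb z') (\<lambda>\<omega>. time_change (- \<alpha>) (Y \<omega>)) = law (Pb z') y"
      by (rule law_cong_AE[OF im[OF z(2)] ym[OF z(2)] inv[OF z(2)]])
    ultimately show "law (Pb z) (\<lambda>\<omega> t. V (y \<omega> t)) = law (Pb z') y" by simp
  qed
  also have "\<dots> \<longleftrightarrow> ?R"
  proof -
    have "lk_path \<alpha> (\<xi> \<omega>) (\<Theta> \<omega>) t = Y \<omega> t" if "u \<in> MAP_states" "\<omega> \<in> space (Pb u)" for u \<omega> t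
      using lk_path_eq_time_change[OF feller that \<alpha>] by (simp add: Y_def y_def[abs_def])
    then show ?thesis
      using law_cong[of "Pb z" "\<lambda>\<omega> t. V (lk_path \<alpha> (\<xi> \<omega>) (\<Theta> \<omega>) t)" "\<lambda>\<omega> t. V (Y \<omega> t)"]
        law_cong[of "Pb z'" "\<lambda>\<omega>. lk_path \<alpha> (\<xi> \<omega>) (\<Theta> \<omega>)" Y] z by simp
  qed
  finally show ?thesis .
qed

theorem theorem3p11:
  fixes \<alpha> :: real
    and P :: "real^'n \<Rightarrow> 'w measure" and Z :: "'w \<Rightarrow> real \<Rightarrow> real^'n"
    and Pb :: "ereal \<times> (real^'n) \<Rightarrow> 'v measure"
    and \<xi> :: "'v \<Rightarrow> real \<Rightarrow> ereal" and \<Theta> :: "'v \<Rightarrow> real \<Rightarrow> real^'n"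
  assumes "CARD('n) \<ge> 2"
    and "\<alpha> > 0"
    and "ssMp \<alpha> P Z"
    and "is_MAP \<xi> \<Theta> Pb"
    and "LK_associated \<alpha> P Z Pb \<xi> \<Theta>"
  shows "isotropic P Z \<longleftrightarrow>
    (\<forall>U :: real^'n^'n. orthogonal_matrix U \<longrightarrow>
       (\<forall>x :: real. \<forall>\<theta>\<in>sphere 0 1.
          law (Pb (ereal x, \<theta>)) (\<lambda>\<omega> t. (\<xi> \<omega> t, matrix_inv U *v \<Theta> \<omega> t))
          = law (Pb (ereal x, matrix_inv U *v \<theta>)) (\<lambda>\<omega> t. (\<xi> \<omega> t, \<Theta> \<omega> t))))"
proof -
  have feller: "feller_process MAP_states {(-\<infinity>, 0)} Pb (\<lambda>\<omega> t. (\<xi> \<omega> t, \<Theta> \<omega> t))"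
    using assms(4) unfolding is_MAP_def by (rule conjunct1)
  have fZ: "feller_process UNIV {} P Z" using assms(3) unfolding ssMp_def by (elim conjE)
  have "\<forall>x\<in>UNIV. \<forall>t\<ge>0. (\<lambda>\<omega>. Z \<omega> t) \<in> borel_measurable (P x)"
    using fZ unfolding feller_process_def by (elim conjE) assumption
  then have Zm: "(\<lambda>\<omega>. Z \<omega> t) \<in> borel_measurable (P x)" if "0 \<le> t" for x t using that by blast
  let ?lk = "\<lambda>\<omega>. lk_path \<alpha> (\<xi> \<omega>) (\<Theta> \<omega>)"
  have lk: "law (Pb (ereal (ln (norm x)), sgn x)) ?lk = law (P x) Z" if "x \<noteq> 0" for x
    using assms(5) that unfolding LK_associated_def by blast
  \<comment> \<open>Isotropy at one nonzero \<open>x\<close> for one \<open>U\<close> is equivalent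
    to the MAP identity at the polar coordinates of \<open>x\<close>. The level is the same on both
    sides because the inverse of \<open>U\<close> preserves the norm.\<close>
  have key: "law (P x) (\<lambda>\<omega> t. matrix_inv U *v Z \<omega> t) = law (P (matrix_inv U *v x)) Z \<longleftrightarrow>
      law (Pb (ereal (ln (norm x)), sgn x)) (\<lambda>\<omega> t. (\<xi> \<omega> t, matrix_inv U *v \<Theta> \<omega> t))
      = law (Pb (ereal (ln (norm x)), matrix_inv U *v sgn x)) (\<lambda>\<omega> t. (\<xi> \<omega> t, \<Theta> \<omega> t))"
    if U: "orthogonal_matrix U" and x: "x \<noteq> 0" for U :: "real^'n^'n" and x
  proof -
    let ?V = "\<lambda>x. matrix_inv U *v x"
    have V: "linear ?V" "norm (?V v) = norm v" for v
      using orthogonal_matrix_inv_isometry[OF U] by (auto simp: matrix_vector_mul_linear)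
    have Vm: "?V \<in> borel_measurable borel"
      using V(1) by (intro borel_measurable_continuous_onI linear_continuous_on linear_conv_bounded_linear[THEN iffD1])
    have sV: "sgn (?V x) = ?V (sgn x)" by (simp add: sgn_div_norm V(2) linear_cmul[OF V(1)])
    have Vx: "?V x \<noteq> 0" using V(2)[of x] x by auto
    have z: "(ereal (ln (norm x)), sgn x) \<in> MAP_states" "(ereal (ln (norm x)), ?V (sgn x)) \<in> MAP_states"
      using x by (auto simp: MAP_states_iff V(2) norm_sgn)
    have lkm: "(\<lambda>\<omega>. ?lk \<omega> t) \<in> borel_measurable (Pb (ereal (ln (norm x)), sgn x))" if "0 \<le> t" for t
    proof -
      have "(\<lambda>\<omega>. time_change \<alpha> (\<lambda>t. eexp (\<xi> \<omega> t) *\<^sub>R \<Theta> \<omega> t) t) \<in> borel_measurable (Pb (ereal (ln (norm x)), sgn x))"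
        using that absorbed_MAP_path[OF feller z(1)]
        by (intro time_change_process_measurable MAP_path_measurable[OF feller z(1)]) (simp_all only: absorbed_path_def)
      then show ?thesis
        by (subst measurable_cong[OF lk_path_eq_time_change[OF feller z(1) _ assms(2)]])
    qed
    have "law (P x) (\<lambda>\<omega> t. ?V (Z \<omega> t)) = law (Pb (ereal (ln (norm x)), sgn x)) (\<lambda>\<omega> t. ?V (?lk \<omega> t))"
      by (rule law_map[OF Zm lkm Vm lk[OF x, symmetric]])
    moreover have "law (P (?V x)) Z = law (Pb (ereal (ln (norm x)), ?V (sgn x))) ?lk"
      using lk[OF Vx] by (simp add: V(2) sV)
    ultimately show ?thesis
      using MAP_law_iff_path_law[OF feller z V] path_law_iff_time_change_law[OF feller z assms(2) V]
      by (simp only:)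
  qed
  \<comment> \<open>The transform says nothing about a start at the origin; there the process almost
    surely stays at 0, which every matrix fixes.\<close>
  have zero: "law (P 0) (\<lambda>\<omega> t. matrix_inv U *v Z \<omega> t) = law (P (matrix_inv U *v 0)) Z" for U :: "real^'n^'n"
  proof -
    have "\<forall>x\<in>UNIV. AE \<omega> in P x. Z \<omega> 0 = x"
      using fZ unfolding feller_process_def by (elim conjE) assumption
    then have "AE \<omega> in P 0. Z \<omega> 0 = 0" by blast
    then have "AE \<omega> in P 0. \<forall>t\<ge>0. matrix_inv U *v Z \<omega> t = Z \<omega> t"
    proof (rule AE_mp[OF _ AE_I2], intro impI allI)
      fix \<omega> and t :: real assume \<omega>: "\<omega> \<in> space (P 0)" "Z \<omega> 0 = 0" "0 \<le> t"
      have "\<forall>x. \<forall>\<omega>\<in>space (P x). \<forall>t\<ge>0. \<forall>s\<ge>0. Z \<omega> t = 0 \<longrightarrow> Z \<omega> (t + s) = 0"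
        using assms(3) unfolding ssMp_def by (elim conjE) assumption
      then have "\<forall>t\<ge>0. \<forall>s\<ge>0. Z \<omega> t = 0 \<longrightarrow> Z \<omega> (t + s) = 0" using \<omega>(1) by blast
      from this[rule_format, of 0 t] have "Z \<omega> t = 0" using \<omega> by simp
      then show "matrix_inv U *v Z \<omega> t = Z \<omega> t" by simp
    qed
    moreover have "(\<lambda>x. matrix_inv U *v x) \<in> borel_measurable borel"
      by (intro borel_measurable_continuous_onI continuous_intros)
    ultimately show ?thesis
      by (simp, intro law_cong_AE Zm measurable_compose[OF Zm])
  qed
  show ?thesis
  proof (intro iffI allI impI ballI)
    fix U :: "real^'n^'n" and x :: real and \<theta> :: "real^'n"
    assume iso: "isotropic P Z" and U: "orthogonal_matrix U" and \<theta>: "\<theta> \<in> sphere 0 1"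
    \<comment> \<open>Each starting state of the MAP consists of the polar coordinates of a nonzero
      vector, so \<open>key\<close> reaches all of them.\<close>
    have "exp x *\<^sub>R \<theta> \<noteq> 0" "ln (norm (exp x *\<^sub>R \<theta>)) = x" "sgn (exp x *\<^sub>R \<theta>) = \<theta>"
      using \<theta> by (auto simp: sgn_div_norm)
    with key[OF U, of "exp x *\<^sub>R \<theta>"] iso U
    show "law (Pb (ereal x, \<theta>)) (\<lambda>\<omega> t. (\<xi> \<omega> t, matrix_inv U *v \<Theta> \<omega> t))
        = law (Pb (ereal x, matrix_inv U *v \<theta>)) (\<lambda>\<omega> t. (\<xi> \<omega> t, \<Theta> \<omega> t))"
      unfolding isotropic_def by metis
  next
    assume map: "\<forall>U :: real^'n^'n. orthogonal_matrix U \<longrightarrow>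
       (\<forall>x :: real. \<forall>\<theta>\<in>sphere 0 1.
          law (Pb (ereal x, \<theta>)) (\<lambda>\<omega> t. (\<xi> \<omega> t, matrix_inv U *v \<Theta> \<omega> t))
          = law (Pb (ereal x, matrix_inv U *v \<theta>)) (\<lambda>\<omega> t. (\<xi> \<omega> t, \<Theta> \<omega> t)))"
    show "isotropic P Z"
      unfolding isotropic_def
    proof (intro allI impI)
      fix U :: "real^'n^'n" and x assume U: "orthogonal_matrix U"
      show "law (P x) (\<lambda>\<omega> t. matrix_inv U *v Z \<omega> t) = law (P (matrix_inv U *v x)) Z"
      proof (cases "x = 0")
        case False
        then have "sgn x \<in> sphere 0 1" by (simp add: norm_sgn)
        then show ?thesis using map U unfolding key[OF U False] by blast
      qed (simp only: zero)
    qed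
  qed
qed

end
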